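(* The singular locus $\mathrm{Sing}(\mathcal H)$ of the hypersurface $\mathcal H\subseteq\mathbb P^5$ of binary quintics in involution coincides with $\mathcal B$, the union of the $SL_2(\mathbf C)$-orbits in $\mathbb P^5=\mathbb P S_5$ of the six points $[\mathbb U_{(1)}],\dots,[\mathbb U_{(6)}]$, where $$\mathbb U_{(1)}=x_1^5+x_2^5,\quad \mathbb U_{(2)}=x_1x_2(x_1-x_2)(x_1^2+x_1x_2+x_2^2),\quad \mathbb U_{(3)}=x_1^3x_2(x_1+x_2),$$ $$\mathbb U_{(4)}=x_1^3x_2^2,\quad \mathbb U_{(5)}=x_1^4x_2,\quad \mathbb U_{(6)}=x_1^5 .$$
   Context: The base field is $\mathbf C$. $S_m$ denotes the space of binary forms of order (homogeneous degree) $m$ in $x_1,x_2$ with its natural $SL_2(\mathbf C)$-action. Let $C=\{[l^2]: l\in S_1\setminus\{0\}\}\subseteq \mathbb P S_2=\mathbb P^2$, a smooth conic. Points of $\mathbb P^5=\mathbb P S_5$ are identified with effective divisors of degree $5$ on $C$, the quintic $[l_1\cdots l_5]$ corresponding to the divisor $[l_1^2]+\dots+[l_5^2]$. The variety $\mathcal H\subseteq \mathbb P^5$ is the closure of the set of all divisors $\mathsf a_1+\mathsf b_1+\mathsf a_2+\mathsf b_2+\mathsf c$ obtained as follows: $\mathsf z\in\mathbb P^2\setminus C$ is a point, $L_1,L_2$ are two lines through $\mathsf z$ with $L_i\cap C=\{\mathsf a_i,\mathsf b_i\}$, and $\mathsf c\in C$ is one of the two points such that the line $\overline{\mathsf c\,\mathsf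 z}$ is tangent to $C$ (at $\mathsf c$). It is an irreducible hypersurface (considered as a reduced variety). *)

theory Defs
  imports "HOL-Analysis.Analysis"
begin

section \<open>Projective varieties\<close>

text \<open>Points of the projective space of \<^typ>\<open>complex^'n\<close> are the one-dimensional subspaces.\<close>

definition proj_space :: "(complex^'n) set set" where
  "proj_space = {p. vec.subspace p \<and> vec.dim p = 1}"

definition proj_lines :: "(complex^'n) set set set" where
  "proj_lines = {{p \<in> proj_space. p \<subseteq> W} |W. vec.subspace W \<and> vec.dim W = 2}"

text \<open>Since \<open>\<complex>\<close> is infinite, polynomials in the coordinates may be identified with the
  functions they define.\<close>

inductive polyfun :: "(complex^'n \<Rightarrow> complex) \<Rightarrow> bool" where
  const: "polyfun (\<lambda>v. c)"
| coord: "polyfun (\<lambda>v. v $ i)"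
| add: "polyfun F \<Longrightarrow> polyfun G \<Longrightarrow> polyfun (\<lambda>v. F v + G v)"
| mult: "polyfun F \<Longrightarrow> polyfun G \<Longrightarrow> polyfun (\<lambda>v. F v * G v)"

definition homogeneous :: "nat \<Rightarrow> (complex^'n \<Rightarrow> complex) \<Rightarrow> bool" where
  "homogeneous d F \<longleftrightarrow> polyfun F \<and> (\<forall>c v. F (c *s v) = c ^ d * F v)"

text \<open>The homogeneous elements of the (radical) vanishing ideal of a set of points.\<close>

definition vanishing :: "(complex^'n) set set \<Rightarrow> (complex^'n \<Rightarrow> complex) set" where
  "vanishing X = {F. (\<exists>d. homogeneous d F) \<and> (\<forall>p\<in>X. \<forall>v\<in>p. F v = 0)}"

definition zariski_closure :: "(complex^'n) set set \<Rightarrow> (complex^'n) set set" where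
  "zariski_closure X = {p \<in> proj_space. \<forall>F\<in>vanishing X. \<forall>v\<in>p. F v = 0}"

text \<open>The embedded projective tangent space at \<open>p\<close> of \<open>X\<close> with its reduced structure. The
  derivative is the differential of \<open>F\<close> at \<open>v\<close>, a vector spanning \<open>p\<close>, applied to \<open>w\<close>.\<close>

definition proj_tangent :: "(complex^'n) set set \<Rightarrow> (complex^'n) set \<Rightarrow> (complex^'n) set set" where
  "proj_tangent X p = {q \<in> proj_space.
     \<forall>F\<in>vanishing X. \<forall>v\<in>p - {0}. \<forall>w\<in>q. deriv (\<lambda>t. F (v + t *s w)) 0 = 0}"

text \<open>Singular points of a reduced \<^emph>\<open>hypersurface\<close>: by the Jacobian criterion in codimension
  one, \<open>p\<close> is singular iff every element of the ideal has zero differential at \<open>p\<close>, that is, iff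
  the tangent space is not a hyperplane but everything. In higher codimension this would be wrong.\<close>

definition hypersurface_sing :: "(complex^'n) set set \<Rightarrow> (complex^'n) set set" where
  "hypersurface_sing X = {p \<in> X. proj_tangent X p = proj_space}"

section \<open>Binary forms\<close>

text \<open>The space of binary forms of order \<open>m\<close> is \<open>\<complex>\<^sup>m\<^sup>+\<^sup>1\<close>, by the coefficients in the monomials
  \<open>x\<^sub>1\<^sup>m, x\<^sub>1\<^sup>m\<^sup>-\<^sup>1x\<^sub>2, \<dots>, x\<^sub>2\<^sup>m\<close>. The index type is a numeral type (here \<open>2\<close>, \<open>3\<close>
  or \<open>6\<close>), so that the values \<open>of_nat k\<close>, \<open>1 \<le> k \<le> m + 1\<close>, run through it once. In particular
  \<open>form l x = l $ 1 * x $ 1 + l $ 2 * x $ 2\<close> for \<open>l\<close> of type \<^typ>\<open>complex^2\<close>.\<close>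

definition form :: "complex^'n::{finite,comm_ring_1} \<Rightarrow> complex^2 \<Rightarrow> complex" where
  "form a x = (\<Sum>k = 1..CARD('n). a $ of_nat k * x $ 1 ^ (CARD('n) - k) * x $ 2 ^ (k - 1))"

text \<open>The point \<open>[f]\<close> of projective space given by a nonzero binary form \<open>f\<close>, the order
  being determined by the type.\<close>

definition form_point :: "(complex^2 \<Rightarrow> complex) \<Rightarrow> (complex^'n::{finite,comm_ring_1}) set" where
  "form_point f = {a. \<exists>c. \<forall>x. form a x = c * f x}"

text \<open>\<open>SL\<^sub>2\<close> acts by \<open>A \<cdot> x\<^sub>i = (\<Sum>j. A\<^sub>j\<^sub>i x\<^sub>j)\<close>, a left action.\<close>

definition sl2_act :: "complex^2^2 \<Rightarrow> (complex^2 \<Rightarrow> complex) \<Rightarrow> (complex^2 \<Rightarrow> complex)" where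
  "sl2_act A f = (\<lambda>x. f (x v* A))"

definition sl2_orbit :: "(complex^2 \<Rightarrow> complex) \<Rightarrow> (complex^'n::{finite,comm_ring_1}) set set" where
  "sl2_orbit f = {form_point (sl2_act A f) |A. det A = 1}"

section \<open>Quintics in involution\<close>

definition sq_point :: "complex^2 \<Rightarrow> (complex^3) set" where
  "sq_point l = form_point (\<lambda>x. form l x ^ 2)"

definition conic :: "(complex^3) set set" where
  "conic = {sq_point l |l. l \<noteq> 0}"

text \<open>The divisor \<open>[l\<^sub>1\<^sup>2] + \<dots> + [l\<^sub>5\<^sup>2]\<close> on the conic is the point \<open>[l\<^sub>1 \<cdots> l\<^sub>5]\<close>. A tangent
  line \<open>L1\<close> or \<open>L2\<close> is allowed; its two intersection points with the conic then coincide.\<close>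

definition involution_divisors :: "(complex^6) set set" where
  "involution_divisors =
    {form_point (\<lambda>x. form a1 x * form b1 x * form a2 x * form b2 x * form c x) |a1 b1 a2 b2 c.
       a1 \<noteq> 0 \<and> b1 \<noteq> 0 \<and> a2 \<noteq> 0 \<and> b2 \<noteq> 0 \<and> c \<noteq> 0 \<and>
       (\<exists>z \<in> proj_space - conic.
          (\<exists>L1\<in>proj_lines. \<exists>L2\<in>proj_lines. L1 \<noteq> L2 \<and> z \<in> L1 \<and> z \<in> L2 \<and>
             L1 \<inter> conic = {sq_point a1, sq_point b1} \<and>
             L2 \<inter> conic = {sq_point a2, sq_point b2}) \<and>
          (\<exists>M\<in>proj_lines. sq_point c \<in> M \<and> z \<in> M \<and> M = proj_tangent conic (sq_point c)))}"

definition involution_hypersurface :: "(complex^6) set set" where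
  "involution_hypersurface = zariski_closure involution_divisors"

definition U1 :: "complex^2 \<Rightarrow> complex" where
  "U1 x = x$1 ^ 5 + x$2 ^ 5"

definition U2 :: "complex^2 \<Rightarrow> complex" where
  "U2 x = x$1 * x$2 * (x$1 - x$2) * (x$1 ^ 2 + x$1 * x$2 + x$2 ^ 2)"

definition U3 :: "complex^2 \<Rightarrow> complex" where
  "U3 x = x$1 ^ 3 * x$2 * (x$1 + x$2)"

definition U4 :: "complex^2 \<Rightarrow> complex" where
  "U4 x = x$1 ^ 3 * x$2 ^ 2"

definition U5 :: "complex^2 \<Rightarrow> complex" where
  "U5 x = x$1 ^ 4 * x$2"

definition U6 :: "complex^2 \<Rightarrow> complex" where
  "U6 x = x$1 ^ 5"

end

theory Submission
  imports Defs "HOL-Computational_Algebra.Fundamental_Theorem_Algebra"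
begin

text \<open>
  A quintic is in involution if its roots can be written \<open>c, d, e, f, g\<close> such that the involution of the
  projective line that exchanges \<open>d\<close> with \<open>e\<close> and \<open>f\<close> with \<open>g\<close> fixes \<open>c\<close>. Each of the fifteen such arrangements of the
  roots is one polynomial equation \<open>invol_aff c d e f g = 0\<close> in the roots. In the plane of the conic this is
  polarity: the point \<open>z\<close> is the Jacobian of the quadratic forms \<open>d e\<close> and \<open>f g\<close>, and it lies on the tangent at \<open>c\<close> iff \<open>c\<close> is
  a root of this Jacobian (\<open>involution_divisorsD\<close>, \<open>involution_divisorsI\<close>). So near a quintic with distinct
  roots the hypersurface is a union of branches, one for each involution that the quintic has.

  Every point of the six orbits is singular. Let \<open>F\<close> be in the ideal of the hypersurface. It vanishes on all forms
  \<open>X (\<alpha> X\<^sup>4 + \<beta> X\<^sup>2 Y\<^sup>2 + \<gamma> Y\<^sup>4)\<close> (\<open>vanishing_kills\<close>). The forms \<open>U1\<close> and \<open>U2\<close> have dihedral symmetry,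
  with five and three involutions, and branches with different tangent hyperplanes pass through them, so the differential of \<open>F\<close> vanishes
  (\<open>singular_U1\<close>, \<open>singular_U2\<close>). At a quintic with a triple root and two other roots, two branches touch: to the tangent directions of
  families of quintics in involution one adds a limit of chords between the branches (\<open>singular_triple_root\<close>). The other
  quintics with a triple root are limits of these or are treated along with them.

  Conversely, let a point be singular. The product of the fifteen equations over the roots is symmetric, hence a polynomial \<open>I\<close> in the
  coefficients of the quintic (\<open>involution_invariant_exists\<close>); it is a multiple of Hermite's invariant, belongs
  to the ideal, and so does its composition with a substitution. If exactly one of the fifteen factors vanishes, then \<open>I\<close>
  has nonzero differential unless there is a triple root (\<open>single_factor_regular\<close>). If two factors
  vanish, the quintic has two involutions, fixing one root each. If the roots are distinct, then so are the fixed roots of the two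
  involutions, which generate a dihedral group of order six or ten, and this puts the quintic into the orbits of \<open>U2\<close> and \<open>U1\<close>
  (\<open>dihedral3_in_orbits\<close>, \<open>dihedral5_in_orbits\<close>). If there are multiple roots, but no triple one, the roots are \<open>a, a, b, b, c\<close>: here the map from roots
  to coefficients is ramified, and the product of the two factors still has nonzero differential
  (\<open>double_double_regular\<close>). Finally, the quintics with a triple root form the orbits of \<open>U3\<close>, \<open>U4\<close>, \<open>U5\<close>,
  \<open>U6\<close> (\<open>triple_root_in_orbits\<close>).
\<close>

section \<open>Binary quintics as coefficient vectors\<close>

lemma exhaust_6: "x = 1 \<or> x = 2 \<or> x = 3 \<or> x = 4 \<or> x = 5 \<or> x = 6" for x :: 6
proof (induct x)
  case (of_int z)
  then have "z = 0 \<or> z = 1 \<or> z = 2 \<or> z = 3 \<or> z = 4 \<or> z = 5" by fastforce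
  then show ?case by auto
qed

lemma all_6: "(\<forall>i::6. P i) \<longleftrightarrow> P 1 \<and> P 2 \<and> P 3 \<and> P 4 \<and> P 5 \<and> P 6"
  by (metis exhaust_6)

definition vec6 :: "'a \<Rightarrow> 'a \<Rightarrow> 'a \<Rightarrow> 'a \<Rightarrow> 'a \<Rightarrow> 'a \<Rightarrow> 'a^6" where
  "vec6 a b c d e f = (\<chi> i. if i = 1 then a else if i = 2 then b else if i = 3 then c
     else if i = 4 then d else if i = 5 then e else f)"

lemma vec6_nth [simp]:
  "vec6 a b c d e f $ 1 = a" "vec6 a b c d e f $ 2 = b" "vec6 a b c d e f $ 3 = c"
  "vec6 a b c d e f $ 4 = d" "vec6 a b c d e f $ 5 = e" "vec6 a b c d e f $ 6 = f"
  by (simp_all add: vec6_def)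

lemma vec6_eq_iff: "v = w \<longleftrightarrow> v$1 = w$1 \<and> v$2 = w$2 \<and> v$3 = w$3 \<and> v$4 = w$4 \<and> v$5 = w$5 \<and> v$6 = w$6"
  for v w :: "'a^6"
  by (simp add: vec_eq_iff all_6)

lemma vec6_eta: "vec6 (v$1) (v$2) (v$3) (v$4) (v$5) (v$6) = v"
  by (simp add: vec6_eq_iff)

lemma form2: "form l x = l$1 * x$1 + l$2 * x$2" for l :: "complex^2"
  by (simp add: form_def numeral_2_eq_2[symmetric] sum.atLeast_Suc_atMost)

lemma form3: "form q x = q$1 * x$1^2 + q$2 * x$1 * x$2 + q$3 * x$2^2" for q :: "complex^3"
  by (simp add: form_def eval_nat_numeral sum.atLeast_Suc_atMost)

lemma form6: "form v x = v$1 * x$1^5 + v$2 * x$1^4 * x$2 + v$3 * x$1^3 * x$2^2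
   + v$4 * x$1^2 * x$2^3 + v$5 * x$1 * x$2^4 + v$6 * x$2^5" for v :: "complex^6"
  by (simp add: form_def eval_nat_numeral sum.atLeast_Suc_atMost)

lemma form_vec6: "form (vec6 a b c d e f) x = a * x$1^5 + b * x$1^4 * x$2 + c * x$1^3 * x$2^2
   + d * x$1^2 * x$2^3 + e * x$1 * x$2^4 + f * x$2^5"
  by (simp add: form6)

lemma vec6_0 [simp]: "vec6 0 0 0 0 0 0 = 0"
  by (simp add: vec6_eq_iff)

lemma vec6_add: "vec6 a b c d e f + vec6 a' b' c' d' e' f' = vec6 (a + a') (b + b') (c + c') (d + d') (e + e') (f + f')"
  for a :: complex
  by (simp add: vec6_eq_iff)

lemma vec6_scale: "k *s vec6 a b c d e f = vec6 (k * a) (k * b) (k * c) (k * d) (k * e) (k * f)"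
  for a :: complex
  by (simp add: vec6_eq_iff)

lemma form_add: "form (v + w) x = form v x + form w x" for v w :: "complex^6"
  by (simp add: form6 algebra_simps)

lemma form_scale: "form (c *s v) x = c * form v x" for v :: "complex^6"
  by (simp add: form6 algebra_simps)

text \<open>The field is infinite, so a form is determined by its values. This turns identities between
  coefficient vectors into polynomial identities in \<open>x\<close>.\<close>
lemma form_inj:
  fixes v w :: "complex^6"
  assumes "\<And>x. form v x = form w x"
  shows "v = w"
proof -
  have "poly [:v$1, v$2, v$3, v$4, v$5, v$6:] t = poly [:w$1, w$2, w$3, w$4, w$5, w$6:] t" for t
    using assms[of "vector [1, t]"] by (simp add: form6 algebra_simps power_numeral_reduce)
  then have "[:v$1, v$2, v$3, v$4, v$5, v$6:] = [:w$1, w$2, w$3, w$4, w$5, w$6:]"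
    by (intro poly_ext)
  then show ?thesis by (simp add: vec6_eq_iff)
qed

text \<open>A form of order \<open>k \<le> 5\<close> is stored with \<open>5 - k\<close> zeros appended, that is, after multiplication by
  \<open>x\<^sub>1\<^sup>5\<^sup>-\<^sup>k\<close>. Multiplying it by a linear form just shifts and adds, and
  \<open>prod5\<close> starts from \<open>x\<^sub>1\<^sup>5\<close>, which stands for the constant \<open>1\<close>.\<close>
definition mul_lin :: "complex^2 \<Rightarrow> complex^6 \<Rightarrow> complex^6" where
  "mul_lin l v = vec6 (l$1 * v$1) (l$1 * v$2 + l$2 * v$1) (l$1 * v$3 + l$2 * v$2)
     (l$1 * v$4 + l$2 * v$3) (l$1 * v$5 + l$2 * v$4) (l$1 * v$6 + l$2 * v$5)"

lemma mul_lin_nth [simp]: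
  "mul_lin l v $ 1 = l$1 * v$1" "mul_lin l v $ 2 = l$1 * v$2 + l$2 * v$1"
  "mul_lin l v $ 3 = l$1 * v$3 + l$2 * v$2" "mul_lin l v $ 4 = l$1 * v$4 + l$2 * v$3"
  "mul_lin l v $ 5 = l$1 * v$5 + l$2 * v$4" "mul_lin l v $ 6 = l$1 * v$6 + l$2 * v$5"
  by (simp_all add: mul_lin_def)

definition prod5 :: "complex^2 \<Rightarrow> complex^2 \<Rightarrow> complex^2 \<Rightarrow> complex^2 \<Rightarrow> complex^2 \<Rightarrow> complex^6" where
  "prod5 a b c d e = mul_lin a (mul_lin b (mul_lin c (mul_lin d (mul_lin e (vec6 1 0 0 0 0 0)))))"

lemma form_prod5: "form (prod5 a b c d e) x = form a x * form b x * form c x * form d x * form e x"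
proof -
  define g4 where "g4 v = v$1 * x$1^4 + v$2 * x$1^3 * x$2
   + v$3 * x$1^2 * x$2^2 + v$4 * x$1 * x$2^3 + v$5 * x$2^4" for v :: "complex^6"
  define g3 where "g3 v = v$1 * x$1^3 + v$2 * x$1^2 * x$2
   + v$3 * x$1 * x$2^2 + v$4 * x$2^3" for v :: "complex^6"
  define g2 where "g2 v = v$1 * x$1^2 + v$2 * x$1 * x$2 + v$3 * x$2^2" for v :: "complex^6"
  have "form (mul_lin l v) x = form l x * g4 v" if "v$6 = 0" for l v
    using that by (simp add: form6 form2 g4_def algebra_simps power_numeral_reduce)
  moreover have "g4 (mul_lin l v) = form l x * g3 v" if "v$5 = 0" for l v
    using that by (simp add: g4_def form2 g3_def algebra_simps power_numeral_reduce)
  moreover have "g3 (mul_lin l v) = form l x * g2 v" if "v$4 = 0" for l v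
    using that by (simp add: g3_def form2 g2_def algebra_simps power_numeral_reduce)
  moreover have "g2 (mul_lin d (mul_lin e (vec6 1 0 0 0 0 0))) = form d x * form e x"
    by (simp add: g2_def form2 algebra_simps power_numeral_reduce)
  ultimately show ?thesis
    by (simp add: prod5_def)
qed

text \<open>The substitution \<open>sl2_act\<close> on coefficient vectors: each monomial \<open>x\<^sub>1\<^sup>5\<^sup>-\<^sup>kx\<^sub>2\<^sup>k\<close>
  becomes \<open>l\<^sup>5\<^sup>-\<^sup>km\<^sup>k\<close>, with \<open>l\<close> and \<open>m\<close> the columns of the matrix. It makes sense for singular
  matrices too, and is linear in \<open>v\<close>.\<close>
definition subst_vars :: "complex^2^2 \<Rightarrow> complex^6 \<Rightarrow> complex^6" where
  "subst_vars A v = (let l = column 1 A; m = column 2 A in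
     v$1 *s prod5 l l l l l + v$2 *s prod5 l l l l m + v$3 *s prod5 l l l m m
     + v$4 *s prod5 l l m m m + v$5 *s prod5 l m m m m + v$6 *s prod5 m m m m m)"

lemma form_column: "form (column i A) x = (x v* A) $ i" for A :: "complex^2^2"
  by (simp add: form2 column_def vector_matrix_mult_def sum_2)

lemma form_subst_vars: "form (subst_vars A v) x = form v (x v* A)"
  by (simp add: subst_vars_def Let_def form_add form_scale form_prod5 form_column form6[of v]
      algebra_simps power_numeral_reduce)

lemma subst_vars_compose: "subst_vars A (subst_vars B v) = subst_vars (A ** B) v"
  by (rule form_inj) (simp add: form_subst_vars vector_matrix_mul_assoc)

lemma subst_vars_id [simp]: "subst_vars (mat 1) v = v"
  by (rule form_inj) (simp add: form_subst_vars)

lemma subst_vars_add: "subst_vars A (v + w) = subst_vars A v + subst_vars A w"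
  by (rule form_inj) (simp add: form_subst_vars form_add)

lemma subst_vars_scale: "subst_vars A (c *s v) = c *s subst_vars A v"
  by (rule form_inj) (simp add: form_subst_vars form_scale)

lemma subst_vars_0 [simp]: "subst_vars A 0 = 0"
  using subst_vars_scale[of A 0 0] by simp

lemma subst_vars_inverse:
  assumes "A ** B = mat 1"
  shows "subst_vars A (subst_vars B v) = v" "subst_vars B (subst_vars A v) = v"
  using assms matrix_left_right_inverse[of A B] by (simp_all add: subst_vars_compose)

lemma subst_vars_prod5: "subst_vars A (prod5 a b c d e) = prod5 (A *v a) (A *v b) (A *v c) (A *v d) (A *v e)"
proof (rule form_inj)
  have "form a (x v* A) = form (A *v a) x" for a :: "complex^2" and x
    by (simp add: form2 vector_matrix_mult_def matrix_vector_mult_def sum_2 algebra_simps)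
  then show "form (subst_vars A (prod5 a b c d e)) x
    = form (prod5 (A *v a) (A *v b) (A *v c) (A *v d) (A *v e)) x" for x
    by (simp add: form_subst_vars form_prod5)
qed

lemma prod5_nonzero:
  assumes "a \<noteq> 0" "b \<noteq> 0" "c \<noteq> 0" "d \<noteq> 0" "e \<noteq> 0"
  shows "prod5 a b c d e \<noteq> 0"
proof
  assume *: "prod5 a b c d e = 0"
  have "poly ([:a$1, a$2:] * [:b$1, b$2:] * [:c$1, c$2:] * [:d$1, d$2:] * [:e$1, e$2:]) t = poly 0 t" for t
  proof -
    have "form a (vector [1, t]) * form b (vector [1, t]) * form c (vector [1, t])
        * form d (vector [1, t]) * form e (vector [1, t]) = 0"
      unfolding form_prod5[symmetric] * by (simp add: form6)
    moreover have "form l (vector [1, t]) = poly [:l$1, l$2:] t" for l :: "complex^2"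
      by (simp add: form2 mult.commute)
    ultimately show ?thesis by (simp only: poly_mult poly_0)
  qed
  then have "[:a$1, a$2:] * [:b$1, b$2:] * [:c$1, c$2:] * [:d$1, d$2:] * [:e$1, e$2:] = 0"
    by (intro poly_ext)
  then show False using assms by (simp only: mult_eq_0_iff) (auto simp: vec_eq_iff forall_2)
qed

text \<open>The matrix of the substitution \<open>x\<^sub>1 \<mapsto> p x\<^sub>1 + q x\<^sub>2\<close>, \<open>x\<^sub>2 \<mapsto> r x\<^sub>1 + s x\<^sub>2\<close>.\<close>
definition mat2 :: "complex \<Rightarrow> complex \<Rightarrow> complex \<Rightarrow> complex \<Rightarrow> complex^2^2" where
  "mat2 p q r s = vector [vector [p, r], vector [q, s]]"

lemma mult_mat2: "(x v* mat2 p q r s) $ 1 = p * x$1 + q * x$2" "(x v* mat2 p q r s) $ 2 = r * x$1 + s * x$2"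
  by (simp_all add: mat2_def vector_matrix_mult_def sum_2)

lemma det_mat2: "det (mat2 p q r s) = p * s - q * r"
  by (simp add: det_2 mat2_def)

lemma subst_vars_diag: "subst_vars (mat2 p 0 0 s) v = vec6 (p^5 * v$1) (p^4 * s * v$2) (p^3 * s^2 * v$3)
    (p^2 * s^3 * v$4) (p * s^4 * v$5) (s^5 * v$6)"
  by (rule form_inj) (simp add: form_subst_vars mult_mat2 form_vec6 form6[of v] power_mult_distrib)

lemma form_point_eq6: "form_point (form v) = range (\<lambda>c. c *s v)" for v :: "complex^6"
proof -
  have "(\<forall>x. form a x = c * form v x) \<longleftrightarrow> a = c *s v" for a c
    using form_inj[of a "c *s v"] by (auto simp: form_scale)
  then show ?thesis unfolding form_point_def by (simp only: full_SetCompr_eq)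
qed

lemma form_point_prod5:
  "form_point (\<lambda>x. form a x * form b x * form c x * form d x * form e x)
    = range (\<lambda>k. k *s prod5 a b c d e)"
  unfolding form_prod5[symmetric] by (rule form_point_eq6)

section \<open>Polynomial functions and their differentials\<close>

lemma polyfun_sum: "(\<And>i. i \<in> I \<Longrightarrow> polyfun (F i)) \<Longrightarrow> polyfun (\<lambda>v. \<Sum>i\<in>I. F i v)"
  by (induction I rule: infinite_finite_induct) (auto intro: polyfun.intros)

lemma polyfun_power: "polyfun F \<Longrightarrow> polyfun (\<lambda>v. F v ^ n)"
  by (induction n) (auto intro: polyfun.intros)

lemma polyfun_diff: "polyfun F \<Longrightarrow> polyfun G \<Longrightarrow> polyfun (\<lambda>v. F v - G v)"
  using polyfun.add[OF _ polyfun.mult[OF polyfun.const[of "-1"]], of F G] by simp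

lemma polyfun_minus: "polyfun F \<Longrightarrow> polyfun (\<lambda>v. - F v)"
  using polyfun.mult[OF polyfun.const[of "-1"], of F] by simp

lemmas polyfun_intros = polyfun.intros polyfun_sum polyfun_power polyfun_diff polyfun_minus

lemma polyfun_compose:
  assumes "polyfun F" "\<And>i. polyfun (\<lambda>v. g v $ i)"
  shows "polyfun (\<lambda>v. F (g v))"
  using assms(1) by induction (auto intro: assms polyfun.intros)

lemma polyfun_subst_vars: "polyfun F \<Longrightarrow> polyfun (\<lambda>v. F (subst_vars A v))"
  by (rule polyfun_compose) (auto simp: subst_vars_def Let_def intro!: polyfun_intros)

text \<open>The difference quotient of a polynomial function is polynomial in base point, direction and
  step together (by the product rule for differences), hence continuous also at step \<open>0\<close>, where it is the
  differential.\<close>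
lemma polyfun_secant:
  assumes "polyfun F"
  obtains G where
    "\<And>v w h. F (v + h *s w) = F v + h * G v w h"
    "continuous_on UNIV (\<lambda>(v, w, h). G v w h)"
    "\<And>v w w'. G v (w + w') 0 = G v w 0 + G v w' 0"
    "\<And>v w c. G v (c *s w) 0 = c * G v w 0"
proof -
  have "\<exists>G. (\<forall>v w h. F (v + h *s w) = F v + h * G v w h) \<and>
    continuous_on UNIV (\<lambda>(v, w, h). G v w h) \<and>
    (\<forall>v w w'. G v (w + w') 0 = G v w 0 + G v w' 0) \<and>
    (\<forall>v w c. G v (c *s w) 0 = c * G v w 0) \<and> continuous_on UNIV F"
    using assms
  proof induction
    case (const c)
    show ?case by (rule exI[of _ "\<lambda>v w h. 0"]) auto
  next
    case (coord i)
    show ?case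
      by (rule exI[of _ "\<lambda>v w h. w $ i"])
        (auto simp: case_prod_unfold intro!: continuous_intros)
  next
    case (add F G)
    then obtain F' G' where "\<forall>v w h. F (v + h *s w) = F v + h * F' v w h"
      "continuous_on UNIV (\<lambda>(v, w, h). F' v w h)"
      "\<forall>v w w'. F' v (w + w') 0 = F' v w 0 + F' v w' 0"
      "\<forall>v w c. F' v (c *s w) 0 = c * F' v w 0" "continuous_on UNIV F"
      "\<forall>v w h. G (v + h *s w) = G v + h * G' v w h"
      "continuous_on UNIV (\<lambda>(v, w, h). G' v w h)"
      "\<forall>v w w'. G' v (w + w') 0 = G' v w 0 + G' v w' 0"
      "\<forall>v w c. G' v (c *s w) 0 = c * G' v w 0" "continuous_on UNIV G"
      by blast
    then show ?case
      by (intro exI[of _ "\<lambda>v w h. F' v w h + G' v w h"])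
        (auto simp: case_prod_unfold algebra_simps intro!: continuous_intros)
  next
    case (mult F G)
    then obtain F' G' where *: "\<forall>v w h. F (v + h *s w) = F v + h * F' v w h"
      "continuous_on UNIV (\<lambda>(v, w, h). F' v w h)"
      "\<forall>v w w'. F' v (w + w') 0 = F' v w 0 + F' v w' 0"
      "\<forall>v w c. F' v (c *s w) 0 = c * F' v w 0" "continuous_on UNIV F"
      "\<forall>v w h. G (v + h *s w) = G v + h * G' v w h"
      "continuous_on UNIV (\<lambda>(v, w, h). G' v w h)"
      "\<forall>v w w'. G' v (w + w') 0 = G' v w 0 + G' v w' 0"
      "\<forall>v w c. G' v (c *s w) 0 = c * G' v w 0" "continuous_on UNIV G"
      by blast
    have "continuous_on UNIV (\<lambda>x::(complex^'a) \<times> (complex^'a) \<times> complex. F (fst x))"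
      "continuous_on UNIV (\<lambda>x::(complex^'a) \<times> (complex^'a) \<times> complex. G (fst x))"
      using *(5,10) by (auto intro!: continuous_on_compose2[of UNIV _ UNIV fst] continuous_intros)
    with * show ?case
      by (intro exI[of _ "\<lambda>v w h. F v * G' v w h + F' v w h * G v + h * F' v w h * G' v w h"])
        (auto simp: case_prod_unfold algebra_simps intro!: continuous_intros)
  qed
  then show ?thesis using that by blast
qed

definition dir_deriv :: "(complex^'n \<Rightarrow> complex) \<Rightarrow> complex^'n \<Rightarrow> complex^'n \<Rightarrow> complex" where
  "dir_deriv F v w = deriv (\<lambda>t. F (v + t *s w)) 0"

lemma isCont_compose_UNIV:
  "continuous_on UNIV G \<Longrightarrow> isCont f a \<Longrightarrow> isCont (\<lambda>t. G (f t)) a"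
  for f :: "'a::t2_space \<Rightarrow> 'b::t2_space"
  using isCont_o2[of a f G] by (simp add: continuous_on_eq_continuous_at)

lemma polyfun_secant_deriv:
  assumes "polyfun F"
  obtains G where
    "\<And>v w h. F (v + h *s w) = F v + h * G (v, w, h)" "continuous_on UNIV G"
    "\<And>v w. dir_deriv F v w = G (v, w, 0)"
    "\<And>v w w'. G (v, w + w', 0) = G (v, w, 0) + G (v, w', 0)"
    "\<And>v w c. G (v, c *s w, 0) = c * G (v, w, 0)"
proof -
  obtain G where G: "\<And>v w h. F (v + h *s w) = F v + h * G v w h"
    "continuous_on UNIV (\<lambda>(v, w, h). G v w h)"
    "\<And>v w w'. G v (w + w') 0 = G v w 0 + G v w' 0"
    "\<And>v w c. G v (c *s w) 0 = c * G v w 0"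
    using polyfun_secant[OF assms] by blast
  have "dir_deriv F v w = G v w 0" for v w
  proof -
    have "isCont (\<lambda>h. (v, w, h)) 0" by (intro continuous_intros)
    from isCont_compose_UNIV[OF G(2) this] have "isCont (\<lambda>h. G v w h) 0" by simp
    then have "((\<lambda>t. F (v + t *s w)) has_field_derivative G v w 0) (at 0)"
      by (intro iffD2[OF CARAT_DERIV] exI[of _ "\<lambda>h. G v w h"]) (auto simp: G(1))
    then show ?thesis unfolding dir_deriv_def by (rule DERIV_imp_deriv)
  qed
  with G that[of "\<lambda>(v, w, h). G v w h"] show ?thesis by simp
qed

lemma dir_deriv_linear:
  assumes "polyfun F"
  shows "dir_deriv F v (w + w') = dir_deriv F v w + dir_deriv F v w'"
    "dir_deriv F v (c *s w) = c * dir_deriv F v w"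
proof -
  obtain G where G: "\<And>v w h. F (v + h *s w) = F v + h * G (v, w, h)" "continuous_on UNIV G"
    "\<And>v w. dir_deriv F v w = G (v, w, 0)"
    "\<And>v w w'. G (v, w + w', 0) = G (v, w, 0) + G (v, w', 0)"
    "\<And>v w c. G (v, c *s w, 0) = c * G (v, w, 0)"
    by (rule polyfun_secant_deriv[OF assms]) (rule that)
  then show "dir_deriv F v (w + w') = dir_deriv F v w + dir_deriv F v w'"
    "dir_deriv F v (c *s w) = c * dir_deriv F v w" by (simp_all add: G(3-5))
qed

lemma isCont_vecI:
  "(\<And>i. isCont (\<lambda>t. f t $ i) a) \<Longrightarrow> isCont f a" for f :: "'a::t2_space \<Rightarrow> complex^'n"
  unfolding isCont_def by (rule vec_tendstoI)

lemma isCont_vec6: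
  fixes x :: "'a::t2_space" and a b c d e f :: "'a \<Rightarrow> complex"
  assumes "isCont a x" "isCont b x" "isCont c x" "isCont d x" "isCont e x" "isCont f x"
  shows "isCont (\<lambda>t. vec6 (a t) (b t) (c t) (d t) (e t) (f t)) x"
proof (rule isCont_vecI)
  fix i :: 6
  show "isCont (\<lambda>t. vec6 (a t) (b t) (c t) (d t) (e t) (f t) $ i) x"
    using exhaust_6[of i] assms by auto
qed

lemma polyfun_isCont:
  assumes "polyfun F" "isCont \<gamma> a"
  shows "isCont (\<lambda>t. F (\<gamma> t)) a"
  using assms by induction (auto intro!: continuous_intros)

lemma dir_deriv_isCont:
  assumes "polyfun F" "isCont \<gamma> a" "isCont \<rho> a"
  shows "isCont (\<lambda>t. dir_deriv F (\<gamma> t) (\<rho> t)) a"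
proof -
  obtain G where G: "\<And>v w h. F (v + h *s w) = F v + h * G (v, w, h)" "continuous_on UNIV G"
    "\<And>v w. dir_deriv F v w = G (v, w, 0)"
    "\<And>v w w'. G (v, w + w', 0) = G (v, w, 0) + G (v, w', 0)"
    "\<And>v w c. G (v, c *s w, 0) = c * G (v, w, 0)"
    by (rule polyfun_secant_deriv[OF assms(1)]) (rule that)
  show ?thesis unfolding G(3)
    using assms by (intro isCont_compose_UNIV[OF G(2)] continuous_intros)
qed

lemma isCont_const_zero_ball:
  fixes f :: "complex \<Rightarrow> complex"
  assumes "isCont f 0" "r > 0" "\<And>t. t \<noteq> 0 \<Longrightarrow> norm t < r \<Longrightarrow> f t = 0"
  shows "f 0 = 0"
proof -
  have "\<forall>\<^sub>F t in at 0. f t = 0"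
    unfolding eventually_at using assms(2,3) by (intro exI[of _ r]) auto
  then have "f \<midarrow>0\<rightarrow> 0" by (rule tendsto_eventually)
  with assms(1) show ?thesis unfolding isCont_def using LIM_unique by blast
qed

lemmas isCont_const_zero = isCont_const_zero_ball[where r = 1, OF _ zero_less_one]

text \<open>Chords of a level set: if \<open>F\<close> takes the same value at the two ends of chords that shrink to a
  point, then the differential there kills the limiting direction of the chords. Curves through the point are
  the case of constant \<open>\<gamma>\<close>; two different curves are needed where branches of a hypersurface touch to
  high order.\<close>
lemma secant_limit:
  assumes "polyfun F" "isCont \<gamma> 0" "isCont \<rho> 0" "n > 0" "r > 0"
    and "\<And>t. t \<noteq> 0 \<Longrightarrow> norm t < r \<Longrightarrow> F (\<gamma> t + t^n *s \<rho> t) = F (\<gamma> t)"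
  shows "dir_deriv F (\<gamma> 0) (\<rho> 0) = 0"
proof -
  obtain G where G: "\<And>v w h. F (v + h *s w) = F v + h * G (v, w, h)" "continuous_on UNIV G"
    "\<And>v w. dir_deriv F v w = G (v, w, 0)"
    "\<And>v w w'. G (v, w + w', 0) = G (v, w, 0) + G (v, w', 0)"
    "\<And>v w c. G (v, c *s w, 0) = c * G (v, w, 0)"
    by (rule polyfun_secant_deriv[OF assms(1)]) (rule that)
  have "isCont (\<lambda>t. G (\<gamma> t, \<rho> t, t^n)) 0"
    using assms by (intro isCont_compose_UNIV[OF G(2)] continuous_intros)
  moreover have "G (\<gamma> t, \<rho> t, t^n) = 0" if "t \<noteq> 0" "norm t < r" for t
    using assms(6)[OF that] G(1) that by simp
  ultimately have "G (\<gamma> 0, \<rho> 0, 0^n) = 0" by (rule isCont_const_zero_ball[OF _ \<open>r > 0\<close>])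
  with \<open>n > 0\<close> show ?thesis by (simp add: G(3) zero_power)
qed

lemma dir_deriv_vec6:
  fixes v :: "complex^6"
  assumes "polyfun F"
  obtains D1 D2 D3 D4 D5 D6 where
    "\<And>a b c d e f. dir_deriv F v (vec6 a b c d e f) = a * D1 + b * D2 + c * D3 + d * D4 + e * D5 + f * D6"
proof (rule that)
  fix a b c d e f :: complex
  have "vec6 a b c d e f = a *s vec6 1 0 0 0 0 0 + b *s vec6 0 1 0 0 0 0 + c *s vec6 0 0 1 0 0 0
    + d *s vec6 0 0 0 1 0 0 + e *s vec6 0 0 0 0 1 0 + f *s vec6 0 0 0 0 0 1"
    by (simp add: vec6_eq_iff)
  then show "dir_deriv F v (vec6 a b c d e f) = a * dir_deriv F v (vec6 1 0 0 0 0 0)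
    + b * dir_deriv F v (vec6 0 1 0 0 0 0) + c * dir_deriv F v (vec6 0 0 1 0 0 0)
    + d * dir_deriv F v (vec6 0 0 0 1 0 0) + e * dir_deriv F v (vec6 0 0 0 0 1 0)
    + f * dir_deriv F v (vec6 0 0 0 0 0 1)"
    by (simp only: dir_deriv_linear[OF assms])
qed

definition singular_at :: "(complex^6 \<Rightarrow> complex) \<Rightarrow> complex^6 \<Rightarrow> bool" where
  "singular_at F v \<longleftrightarrow> F v = 0 \<and> (\<forall>w. dir_deriv F v w = 0)"

lemma singular_atI:
  assumes "\<And>a b c d e f. dir_deriv F v (vec6 a b c d e f) = a * D1 + b * D2 + c * D3 + d * D4 + e * D5 + f * D6"
    and "F v = 0" "D1 = 0" "D2 = 0" "D3 = 0" "D4 = 0" "D5 = 0" "D6 = 0"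
  shows "singular_at F v"
  unfolding singular_at_def
proof (intro conjI allI)
  show "dir_deriv F v w = 0" for w
    using assms(1)[of "w$1" "w$2" "w$3" "w$4" "w$5" "w$6"] assms(3-) by (simp add: vec6_eta)
qed fact

section \<open>Apolarity on the plane of the conic\<close>

definition bracket :: "complex^2 \<Rightarrow> complex^2 \<Rightarrow> complex" where
  "bracket l m = l$1 * m$2 - l$2 * m$1"

definition mul2 :: "complex^2 \<Rightarrow> complex^2 \<Rightarrow> complex^3" where
  "mul2 l m = vector [l$1 * m$1, l$1 * m$2 + l$2 * m$1, l$2 * m$2]"

text \<open>The \<open>SL\<^sub>2\<close>-invariant pairing of binary quadratic forms, that is, polarity with respect to the
  conic. A square \<open>l\<^sup>2\<close> is apolar to \<open>q\<close> iff \<open>l\<close> divides \<open>q\<close>, so the points apolar to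
  \<open>a b\<close> are the line through \<open>a\<^sup>2\<close> and \<open>b\<^sup>2\<close> (the tangent line if \<open>a = b\<close>).\<close>
definition apolar :: "complex^3 \<Rightarrow> complex^3 \<Rightarrow> complex" where
  "apolar u q = 2 * u$1 * q$3 - u$2 * q$2 + 2 * u$3 * q$1"

text \<open>Up to a constant, this is the Jacobian of the quadratic forms \<open>d e\<close> and \<open>f g\<close>, evaluated at the
  root of \<open>c\<close>. The roots of the Jacobian are the fixed points of the involution that exchanges the
  roots of \<open>d\<close> and \<open>e\<close>, and those of \<open>f\<close> and \<open>g\<close>.\<close>
definition invol :: "complex^2 \<Rightarrow> complex^2 \<Rightarrow> complex^2 \<Rightarrow> complex^2 \<Rightarrow> complex^2 \<Rightarrow> complex" where
  "invol c d e f g = bracket d c * bracket f c * bracket g e + bracket e c * bracket g c * bracket f d"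

lemma mul2_nth [simp]: "mul2 l m $ 1 = l$1 * m$1" "mul2 l m $ 2 = l$1 * m$2 + l$2 * m$1"
  "mul2 l m $ 3 = l$2 * m$2"
  by (simp_all add: mul2_def)

lemma form_mul2: "form (mul2 l m) x = form l x * form m x"
  by (simp add: form3 form2 power2_eq_square algebra_simps)

lemma form3_inj:
  fixes v w :: "complex^3"
  assumes "\<And>x. form v x = form w x"
  shows "v = w"
proof -
  have "poly [:v$1, v$2, v$3:] t = poly [:w$1, w$2, w$3:] t" for t
    using assms[of "vector [1, t]"] by (simp add: form3 algebra_simps power2_eq_square)
  then have "[:v$1, v$2, v$3:] = [:w$1, w$2, w$3:]"
    by (intro poly_ext)
  then show ?thesis by (simp add: vec_eq_iff forall_3)
qed

lemma form3_scale: "form (c *s v) x = c * form v x" for v :: "complex^3"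
  by (simp add: form3 algebra_simps)

lemma form_point_eq3: "form_point (form v) = range (\<lambda>c. c *s v)" for v :: "complex^3"
proof -
  have "(\<forall>x. form a x = c * form v x) \<longleftrightarrow> a = c *s v" for a c
    using form3_inj[of a "c *s v"] by (auto simp: form3_scale)
  then show ?thesis unfolding form_point_def by (simp only: full_SetCompr_eq)
qed

lemma sq_point_eq: "sq_point l = range (\<lambda>c. c *s mul2 l l)"
proof -
  have "(\<lambda>x. form l x ^ 2) = form (mul2 l l)"
    by (simp add: form_mul2 power2_eq_square fun_eq_iff)
  then show ?thesis by (simp add: sq_point_def form_point_eq3)
qed

lemma range_scale_span: "range (\<lambda>c. c *s v) = vec.span {v}" for v :: "complex^'n"
  by (auto simp: vec.span_singleton)

lemma proj_space_range: "v \<noteq> 0 \<Longrightarrow> range (\<lambda>c. c *s v) \<in> proj_space" for v :: "complex^'n"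
  unfolding range_scale_span proj_space_def
  by (simp add: vec.dim_span_eq_card_independent)

lemma proj_spaceE:
  assumes "p \<in> proj_space"
  obtains v :: "complex^'n" where "v \<noteq> 0" "p = range (\<lambda>c. c *s v)"
proof -
  have subst_vars: "vec.subspace p" and dim: "vec.dim p = 1" using assms by (auto simp: proj_space_def)
  obtain B where B: "B \<subseteq> p" "vec.independent B" "p \<subseteq> vec.span B" "card B = 1"
    using vec.basis_exists[of p] dim by metis
  then obtain v where v: "B = {v}" by (auto simp: card_1_singleton_iff)
  have "vec.span B = p" using B subst_vars by (simp add: vec.span_subspace)
  moreover have "v \<noteq> 0" using B v by (auto simp: vec.dependent_def)
  ultimately show ?thesis using that v by (simp add: range_scale_span)
qed

lemma range_scale_subset: "vec.subspace W \<Longrightarrow> range (\<lambda>c. c *s v) \<subseteq> W \<longleftrightarrow> v \<in> W" for v :: "complex^'n"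
  unfolding range_scale_span using vec.span_minimal[of "{v}" W] vec.span_superset[of "{v}"] by auto

lemma self_in_range_scale: "v \<in> range (\<lambda>c. c *s v)" for v :: "complex^'n"
  using rangeI[of "\<lambda>c. c *s v" 1] by simp

lemma range_scale_eqD: "range (\<lambda>c. c *s v) = range (\<lambda>c. c *s w) \<Longrightarrow> \<exists>c. v = c *s w" for v w :: "complex^'n"
  using self_in_range_scale[of v] by auto

lemma range_scale_eqI:
  fixes v :: "complex^'n"
  assumes "k \<noteq> 0"
  shows "range (\<lambda>c. c *s (k *s v)) = range (\<lambda>c. c *s v)"
proof -
  have "c *s v = (c / k) *s (k *s v)" for c using assms by simp
  then have "c *s v \<in> range (\<lambda>c. c *s (k *s v))" for c by blast
  then show ?thesis by auto
qed

lemma bracket_eq_0D: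
  assumes "bracket l m = 0" "m \<noteq> 0"
  shows "\<exists>k. l = k *s m"
proof (cases "m$1 = 0")
  case True
  with assms show ?thesis
    by (intro exI[of _ "l$2 / m$2"]) (auto simp: bracket_def vec_eq_iff forall_2)
next
  case False
  with assms show ?thesis
    by (intro exI[of _ "l$1 / m$1"]) (auto simp: bracket_def vec_eq_iff forall_2 field_simps)
qed

lemma mul2_eq_0_iff [simp]: "mul2 l m = 0 \<longleftrightarrow> l = 0 \<or> m = 0"
  by (auto simp: vec_eq_iff forall_2 forall_3)

lemma sq_point_eqI:
  assumes "bracket l m = 0" "l \<noteq> 0" "m \<noteq> 0"
  shows "sq_point l = sq_point m"
proof -
  obtain k where k: "l = k *s m" using bracket_eq_0D assms by blast
  then have "mul2 l l = k^2 *s mul2 m m"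
    by (simp add: vec_eq_iff forall_3 power2_eq_square)
  moreover have "k \<noteq> 0" using k assms by auto
  ultimately show ?thesis using range_scale_eqI[of "k^2" "mul2 m m"] by (simp only: sq_point_eq) simp
qed

lemma sq_point_eqD:
  assumes "sq_point l = sq_point m"
  shows "bracket l m = 0"
proof -
  obtain k where "mul2 l l = k *s mul2 m m" using assms range_scale_eqD unfolding sq_point_eq by blast
  then have "l$1*l$1 = k*(m$1*m$1)" "l$2*l$2 = k*(m$2*m$2)" "2 * l$1*l$2 = 2*k*(m$1*m$2)"
    by (auto simp: vec_eq_iff forall_3 algebra_simps)
  then have "(bracket l m)^2 = 0" unfolding bracket_def by algebra
  then show ?thesis by simp
qed

text \<open>The equation of the conic.\<close>
definition disc :: "complex^3 \<Rightarrow> complex" where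
  "disc u = (u$2)^2 - 4 * u$1 * u$3"

lemma disc_eq_0D:
  assumes "disc u = 0"
  shows "\<exists>l. u = mul2 l l"
proof (cases "u$1 = 0")
  case True
  then show ?thesis using assms
    by (intro exI[of _ "vector [0, csqrt (u$3)]"]) (auto simp: disc_def vec_eq_iff forall_3 simp flip: power2_eq_square)
next
  case False
  then show ?thesis using assms
    by (intro exI[of _ "vector [csqrt (u$1), u$2 / (2 * csqrt (u$1))]"])
      (auto simp: disc_def vec_eq_iff forall_3 field_simps simp flip: power2_eq_square)
qed

lemma apolar_mul2: "apolar (mul2 l l) (mul2 a b) = 2 * bracket l a * bracket l b"
  by (simp add: apolar_def bracket_def algebra_simps)

lemma apolar_commute: "apolar u v = apolar v u"
  by (simp add: apolar_def algebra_simps)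

lemma apolar_add: "apolar (u + v) w = apolar u w + apolar v w"
  by (simp add: apolar_def algebra_simps)

lemma apolar_scale: "apolar (c *s u) w = c * apolar u w"
  by (simp add: apolar_def algebra_simps)

lemma subspace_apolar: "vec.subspace {u. apolar u q = 0}"
  by (auto simp: vec.subspace_def apolar_add apolar_scale) (simp add: apolar_def)

text \<open>The three apolarity conditions are linear equations for \<open>u \<noteq> 0\<close>, and their
  determinant is a multiple of \<open>invol\<close>.\<close>
lemma invol_eq_apolar:
  assumes "u \<noteq> 0" "apolar u (mul2 d e) = 0" "apolar u (mul2 f g) = 0" "apolar u (mul2 c c) = 0"
  shows "invol c d e f g = 0"
proof -
  have "u$1 * invol c d e f g = 0" "u$2 * invol c d e f g = 0" "u$3 * invol c d e f g = 0"
    using assms(2-4) unfolding invol_def bracket_def apolar_def mul2_nth by algebra+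
  moreover have "u$1 \<noteq> 0 \<or> u$2 \<noteq> 0 \<or> u$3 \<noteq> 0"
    using assms(1) by (auto simp: vec_eq_iff forall_3)
  ultimately show ?thesis by auto
qed

text \<open>A line through \<open>[u]\<close> that meets the conic in \<open>[a\<^sup>2]\<close> and \<open>[b\<^sup>2]\<close> only. If \<open>u\<close> were
  not apolar to \<open>a b\<close>, then \<open>W\<close> would contain another point of the conic: for independent \<open>a, b\<close> the
  form \<open>a b\<close> would be a combination of \<open>u\<close>, \<open>a\<^sup>2\<close>, \<open>b\<^sup>2\<close>, and \<open>(a + b)\<^sup>2\<close> would lie in \<open>W\<close>; for
  \<open>a = b\<close> the line through \<open>a\<^sup>2\<close> and \<open>u\<close> would meet the conic a second time.\<close>
lemma apolar_secant_line:
  assumes W: "vec.subspace W" "u \<in> W" and ab: "a \<noteq> 0" "b \<noteq> 0"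
    and int: "{p \<in> proj_space. p \<subseteq> W} \<inter> conic = {sq_point a, sq_point b}"
  shows "apolar u (mul2 a b) = 0"
proof (rule ccontr)
  assume B: "apolar u (mul2 a b) \<noteq> 0"
  have mem: "sq_point l \<in> {p \<in> proj_space. p \<subseteq> W} \<inter> conic \<longleftrightarrow> mul2 l l \<in> W" if "l \<noteq> 0" for l
    using that W(1) range_scale_subset[of W "mul2 l l"] proj_space_range[of "mul2 l l"]
    by (auto simp: sq_point_eq[symmetric] conic_def)
  have on: "bracket l a = 0 \<or> bracket l b = 0" if "mul2 l l \<in> W" "l \<noteq> 0" for l
    using mem[OF that(2)] that(1) unfolding int by (auto dest: sq_point_eqD)
  have aW: "mul2 a a \<in> W" and bW: "mul2 b b \<in> W"
    using mem[of a] mem[of b] ab unfolding int by auto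
  show False
  proof (cases "bracket a b = 0")
    case True
    then obtain k where k: "a = k *s b" using bracket_eq_0D ab by blast
    define B' where "B' = apolar u (mul2 a a)"
    have "B' = k * apolar u (mul2 a b)"
      unfolding B'_def k by (simp add: apolar_def algebra_simps)
    moreover have "k \<noteq> 0" using k ab by auto
    ultimately have "B' \<noteq> 0" using B by simp
    \<comment> \<open>the second intersection of the line through \<open>a\<^sup>2\<close> and \<open>u\<close> with the conic\<close>
    define p where "p = disc u *s mul2 a a + (2 * B') *s u"
    have "p \<in> W" unfolding p_def using W aW by (intro vec.subspace_add vec.subspace_scale)
    have "disc p = 0"
      unfolding p_def B'_def by (simp add: disc_def apolar_def) algebra
    then obtain l where l: "p = mul2 l l" using disc_eq_0D by blast
    have "apolar p (mul2 a a) = 2 * B'^2"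
      unfolding p_def B'_def by (simp add: apolar_add apolar_scale apolar_mul2 power2_eq_square bracket_def)
    then have "bracket l a \<noteq> 0"
      using \<open>B' \<noteq> 0\<close> unfolding l apolar_mul2 by auto
    moreover have "bracket l a = k * bracket l b" by (simp add: k bracket_def algebra_simps)
    moreover have "l \<noteq> 0" using \<open>bracket l a \<noteq> 0\<close> by (auto simp: bracket_def)
    ultimately show False using on[of l] \<open>p \<in> W\<close> l by auto
  next
    case False
    define B' where "B' = apolar u (mul2 a b)"
    have B': "B' \<noteq> 0" using B by (simp add: B'_def)
    have "mul2 (a + b) (a + b) = mul2 a a + mul2 b b + (1 / B') *s
        ((- 2 * (bracket a b)^2) *s u + apolar u (mul2 b b) *s mul2 a a + apolar u (mul2 a a) *s mul2 b b)"
    proof -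
      have "B' *s (2 *s mul2 a b) =
        (- 2 * (bracket a b)^2) *s u + apolar u (mul2 b b) *s mul2 a a + apolar u (mul2 a a) *s mul2 b b"
        by (simp add: vec_eq_iff forall_3 B'_def apolar_def bracket_def power2_eq_square algebra_simps)
      then have "2 *s mul2 a b = (1 / B') *s
        ((- 2 * (bracket a b)^2) *s u + apolar u (mul2 b b) *s mul2 a a + apolar u (mul2 a a) *s mul2 b b)"
        using B' by (metis vec.scale_scale nonzero_divide_eq_eq vec.scale_one mult.commute)
      moreover have "mul2 (a + b) (a + b) = mul2 a a + mul2 b b + 2 *s mul2 a b"
        by (simp add: vec_eq_iff forall_3 algebra_simps)
      ultimately show ?thesis by simp
    qed
    also have "\<dots> \<in> W"
      using W aW bW by (intro vec.subspace_add vec.subspace_scale)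
    finally have "bracket (a + b) a = 0 \<or> bracket (a + b) b = 0"
      using False by (intro on) (auto simp: bracket_def add_eq_0_iff)
    with False show False by (auto simp: bracket_def algebra_simps)
  qed
qed

lemma polyfun_disc: "polyfun disc"
  unfolding disc_def[abs_def] by (intro polyfun_intros)

lemma disc_vanishing: "disc \<in> vanishing conic"
proof -
  have "homogeneous 2 disc"
    using polyfun_disc by (auto simp: homogeneous_def disc_def power_mult_distrib power2_eq_square algebra_simps)
  moreover have "disc (c *s mul2 l l) = 0" for c l
    by (simp add: disc_def power2_eq_square algebra_simps)
  ultimately show ?thesis by (auto simp: vanishing_def conic_def sq_point_eq)
qed

lemma dir_deriv_disc: "dir_deriv disc v w = - 2 * apolar v w"
proof -
  have "((\<lambda>t. disc (v + t *s w)) has_field_derivative - 2 * apolar v w) (at 0)"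
    unfolding disc_def by (auto intro!: derivative_eq_intros simp: apolar_def algebra_simps)
  then show ?thesis unfolding dir_deriv_def by (rule DERIV_imp_deriv)
qed

lemma apolar_square_factor:
  assumes "apolar u (mul2 c c) = 0" "c \<noteq> 0"
  shows "\<exists>m. u = mul2 c m"
proof (cases "c$1 = 0")
  case True
  with assms show ?thesis
    by (intro exI[of _ "vector [u$2 / c$2, u$3 / c$2]"]) (auto simp: apolar_def vec_eq_iff forall_2 forall_3)
next
  case False
  have "2 * (u$3 * (c$1 * c$1)) = 2 * (c$2 * (u$2 * c$1 - c$2 * u$1))"
    using assms(1) by (simp add: apolar_def algebra_simps)
  then have "u$3 * (c$1 * c$1) = c$2 * (u$2 * c$1 - c$2 * u$1)"
    by (simp only: mult_cancel_left) simp
  with False show ?thesis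
    by (intro exI[of _ "vector [u$1 / c$1, (u$2 - c$2 * u$1 / c$1) / c$1]"])
      (auto simp: vec_eq_iff forall_3 field_simps)
qed

text \<open>The differential of \<open>disc\<close> at \<open>c\<^sup>2\<close> is apolarity to \<open>c\<^sup>2\<close>, so the tangent line
  is contained in the polar line. Conversely a form apolar to \<open>c\<^sup>2\<close> is \<open>c m\<close>, and the points \<open>(c + t m)\<^sup>2\<close> of the conic
  leave \<open>c\<^sup>2\<close> in this direction.\<close>
lemma proj_tangent_conic:
  assumes "c \<noteq> 0"
  shows "proj_tangent conic (sq_point c) = {p \<in> proj_space. p \<subseteq> {u. apolar u (mul2 c c) = 0}}"
proof -
  have 1: "apolar w (mul2 c c) = 0" if "q \<in> proj_tangent conic (sq_point c)" "w \<in> q" for q w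
  proof -
    have "mul2 c c \<in> sq_point c - {0}"
      using assms self_in_range_scale[of "mul2 c c"] by (simp add: sq_point_eq)
    then have "dir_deriv disc (mul2 c c) w = 0"
      using that disc_vanishing unfolding proj_tangent_def dir_deriv_def by blast
    then show ?thesis by (simp add: dir_deriv_disc apolar_commute)
  qed
  have 2: "dir_deriv F v w = 0"
    if Fv: "F \<in> vanishing conic" and v: "v \<in> sq_point c - {0}" and w: "apolar w (mul2 c c) = 0"
    for F v w
  proof -
    obtain k where k: "v = k *s mul2 c c" "k \<noteq> 0" using v by (auto simp: sq_point_eq)
    obtain m where m: "w = mul2 c m" using apolar_square_factor w assms by blast
    have F: "polyfun F" using Fv by (auto simp: vanishing_def homogeneous_def)
    have F0: "F (r *s mul2 l l) = 0" if "l \<noteq> 0" for l r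
    proof -
      have "sq_point l \<in> conic" using that by (auto simp: conic_def)
      moreover have "r *s mul2 l l \<in> sq_point l" unfolding sq_point_eq by (rule rangeI)
      ultimately show ?thesis using Fv by (auto simp: vanishing_def)
    qed
    have F0': "F (r *s mul2 l l) = 0" for l r
    proof (cases "l = 0")
      case True
      then have "r *s mul2 l l = 0 *s mul2 c c" by (simp add: vec_eq_iff forall_3)
      then show ?thesis by (simp only: F0[OF assms])
    qed (rule F0)
    have "dir_deriv F v (w + (0 / (4 * k)) *s mul2 m m) = 0"
    proof (rule secant_limit[of F "\<lambda>t. v" "\<lambda>t. w + (t / (4 * k)) *s mul2 m m" 1 1, OF F])
      show "F (v + t ^ 1 *s (w + (t / (4 * k)) *s mul2 m m)) = F v" for t
      proof -
        have "v + t ^ 1 *s (w + (t / (4 * k)) *s mul2 m m)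
          = k *s mul2 (c + (t / (2 * k)) *s m) (c + (t / (2 * k)) *s m)"
          using k by (simp add: m vec_eq_iff forall_3 field_simps)
        then show ?thesis using F0' k by simp
      qed
      have "isCont (\<lambda>t. (t / (4 * k)) *s mul2 m m) 0"
        using k(2) by (intro isCont_vecI) (auto intro!: continuous_intros)
      then show "isCont (\<lambda>t. w + (t / (4 * k)) *s mul2 m m) 0"
        by (intro continuous_intros)
    qed auto
    then show ?thesis by simp
  qed
  show ?thesis
  proof (intro set_eqI iffI)
    fix q assume q: "q \<in> proj_tangent conic (sq_point c)"
    then have "q \<in> proj_space" by (simp add: proj_tangent_def)
    with 1[OF q] show "q \<in> {p \<in> proj_space. p \<subseteq> {u. apolar u (mul2 c c) = 0}}" by blast
  next
    fix q assume q: "q \<in> {p \<in> proj_space. p \<subseteq> {u. apolar u (mul2 c c) = 0}}"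
    then have "dir_deriv F v w = 0" if "F \<in> vanishing conic" "v \<in> sq_point c - {0}" "w \<in> q" for F v w
      using that 2[of F v w] by blast
    with q show "q \<in> proj_tangent conic (sq_point c)"
      unfolding proj_tangent_def dir_deriv_def[symmetric] by simp
  qed
qed

section \<open>Divisors in involution\<close>

text \<open>The point \<open>z\<close> is apolar to \<open>a b\<close> and \<open>d e\<close>, since it is on the lines \<open>L1\<close> and \<open>L2\<close>, and to
  \<open>c\<^sup>2\<close>, since it is on the tangent at \<open>c\<close>.\<close>
lemma involution_divisorsD:
  assumes "p \<in> involution_divisors"
  obtains a b d e c where "a \<noteq> 0" "b \<noteq> 0" "d \<noteq> 0" "e \<noteq> 0" "c \<noteq> 0" "invol c a b d e = 0"
    "p = range (\<lambda>k. k *s prod5 a b d e c)"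
proof -
  obtain a b d e c where nz: "a \<noteq> 0" "b \<noteq> 0" "d \<noteq> 0" "e \<noteq> 0" "c \<noteq> 0"
    and p: "p = range (\<lambda>k. k *s prod5 a b d e c)"
    and ex: "\<exists>z \<in> proj_space - conic.
          (\<exists>L1\<in>proj_lines. \<exists>L2\<in>proj_lines. L1 \<noteq> L2 \<and> z \<in> L1 \<and> z \<in> L2 \<and>
             L1 \<inter> conic = {sq_point a, sq_point b} \<and> L2 \<inter> conic = {sq_point d, sq_point e}) \<and>
          (\<exists>M\<in>proj_lines. sq_point c \<in> M \<and> z \<in> M \<and> M = proj_tangent conic (sq_point c))"
    using assms unfolding involution_divisors_def form_point_prod5 mem_Collect_eq
    by (elim exE conjE) (rule that)
  then obtain z L1 L2 where z: "z \<in> proj_space"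
    and L: "L1 \<in> proj_lines" "L2 \<in> proj_lines" "z \<in> L1" "z \<in> L2"
      "L1 \<inter> conic = {sq_point a, sq_point b}" "L2 \<inter> conic = {sq_point d, sq_point e}"
    and M: "z \<in> proj_tangent conic (sq_point c)"
    by blast
  obtain u where u: "u \<noteq> 0" "z = range (\<lambda>k. k *s u)" using z by (rule proj_spaceE)
  have uz: "u \<in> z" unfolding u(2) by (rule self_in_range_scale)
  have on_line: "apolar u (mul2 f g) = 0"
    if line: "L \<in> proj_lines" "z \<in> L" "L \<inter> conic = {sq_point f, sq_point g}" and "f \<noteq> 0" "g \<noteq> 0" for L f g
  proof -
    obtain W where W: "L = {p \<in> proj_space. p \<subseteq> W}" "vec.subspace W"
      using line(1) unfolding proj_lines_def by blast
    have "u \<in> W" using uz line(2) unfolding W(1) by blast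
    with W that show ?thesis using apolar_secant_line[of W u f g] by simp
  qed
  have "apolar u (mul2 a b) = 0" by (rule on_line[OF L(1,3,5) nz(1,2)])
  moreover have "apolar u (mul2 d e) = 0" by (rule on_line[OF L(2,4,6) nz(3,4)])
  moreover have "apolar u (mul2 c c) = 0"
    using M uz unfolding proj_tangent_conic[OF nz(5)] by blast
  ultimately have "invol c a b d e = 0" using u(1) invol_eq_apolar by blast
  with that nz p show ?thesis by blast
qed

lemma exists_apolar_nonzero:
  assumes "q \<noteq> 0"
  shows "\<exists>u. apolar u q \<noteq> 0"
proof -
  consider "q$1 \<noteq> 0" | "q$2 \<noteq> 0" | "q$3 \<noteq> 0" using assms by (auto simp: vec_eq_iff forall_3)
  then show ?thesis
  proof cases
    case 1 then show ?thesis by (intro exI[of _ "vector [0,0,1]"]) (simp add: apolar_def)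
  next
    case 2 then show ?thesis by (intro exI[of _ "vector [0,1,0]"]) (simp add: apolar_def)
  next
    case 3 then show ?thesis by (intro exI[of _ "vector [1,0,0]"]) (simp add: apolar_def)
  qed
qed

text \<open>The kernel of a nonzero linear functional has codimension one.\<close>
lemma apolar_line:
  assumes "q \<noteq> 0"
  shows "{p \<in> proj_space. p \<subseteq> {u. apolar u q = 0}} \<in> proj_lines"
proof -
  let ?W = "{u. apolar u q = 0}"
  obtain x where x: "apolar x q \<noteq> 0" using exists_apolar_nonzero assms by blast
  have span: "vec.span ?W = ?W" using subspace_apolar by (simp add: vec.span_eq_iff)
  have "u \<in> vec.span (insert x ?W)" for u
  proof -
    have "u - (apolar u q / apolar x q) *s x \<in> ?W"
      using x by (simp add: diff_conv_add_uminus apolar_add apolar_scale flip: vec.scale_minus_left)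
    then show ?thesis unfolding vec.span_insert span by blast
  qed
  then have "vec.span (insert x ?W) = UNIV" by blast
  then have "vec.dim (insert x ?W) = vec.dim (UNIV :: (complex^3) set)"
    using vec.dim_span[of "insert x ?W"] by metis
  then have "vec.dim (insert x ?W) = 3"
    unfolding vec_dim_card by simp
  moreover have "x \<notin> vec.span ?W" using x by (simp add: span)
  ultimately have "vec.dim ?W = 2" by (simp add: vec.dim_insert)
  then show ?thesis using subspace_apolar unfolding proj_lines_def by blast
qed

text \<open>The pole of the involution: for independent \<open>q, r\<close>, the one form (up to scalars) apolar to both.\<close>
definition jacobian :: "complex^3 \<Rightarrow> complex^3 \<Rightarrow> complex^3" where
  "jacobian q r = vector [q$1 * r$2 - q$2 * r$1, 2 * (q$1 * r$3 - q$3 * r$1), q$2 * r$3 - q$3 * r$2]"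

lemma apolar_jacobian: "apolar (jacobian q r) q = 0" "apolar (jacobian q r) r = 0"
  by (simp_all add: apolar_def jacobian_def algebra_simps)

lemma apolar_jacobian_square: "apolar (jacobian (mul2 d e) (mul2 f g)) (mul2 c c) = - 2 * invol c d e f g"
  by (simp add: apolar_def jacobian_def invol_def bracket_def algebra_simps)

lemma disc_jacobian:
  "disc (jacobian (mul2 a b) (mul2 d e)) = 4 * bracket a d * bracket a e * bracket b d * bracket b e"
  by (simp add: disc_def jacobian_def bracket_def) algebra

text \<open>For two pairs without a common root, the point \<open>z\<close> is the Jacobian of the two quadratic forms: its
  discriminant is a multiple of their resultant, so \<open>z\<close> is off the conic.\<close>
lemma involution_divisorsI:
  assumes nz: "a \<noteq> 0" "b \<noteq> 0" "d \<noteq> 0" "e \<noteq> 0" "c \<noteq> 0" and inv: "invol c a b d e = 0"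
    and bracket: "bracket a d \<noteq> 0" "bracket a e \<noteq> 0" "bracket b d \<noteq> 0" "bracket b e \<noteq> 0"
  shows "range (\<lambda>k. k *s prod5 a b d e c) \<in> involution_divisors"
proof -
  define u where "u = jacobian (mul2 a b) (mul2 d e)"
  define z where "z = range (\<lambda>k. k *s u)"
  define L where "L q = {p \<in> proj_space. p \<subseteq> {w. apolar w q = 0}}" for q
  have du: "disc u \<noteq> 0" unfolding u_def disc_jacobian using bracket by simp
  then have "u \<noteq> 0" by (auto simp: disc_def)
  then have z: "z \<in> proj_space" unfolding z_def by (rule proj_space_range)
  have "z \<notin> conic"
  proof
    assume "z \<in> conic"
    then obtain l where "z = range (\<lambda>k. k *s mul2 l l)" unfolding conic_def sq_point_eq by blast
    then obtain k where "u = k *s mul2 l l" unfolding z_def using range_scale_eqD by blast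
    then have "disc u = 0" by (simp add: disc_def power2_eq_square algebra_simps)
    with du show False by simp
  qed
  have mem: "range (\<lambda>k. k *s w) \<in> L q \<longleftrightarrow> apolar w q = 0" if "w \<noteq> 0" for w q
    using proj_space_range[OF that] range_scale_subset[OF subspace_apolar] unfolding L_def by blast
  have zL: "z \<in> L (mul2 a b)" "z \<in> L (mul2 d e)" "z \<in> L (mul2 c c)"
    using inv \<open>u \<noteq> 0\<close> by (simp_all add: z_def mem u_def apolar_jacobian apolar_jacobian_square)
  have sq: "sq_point l \<in> L (mul2 f g) \<longleftrightarrow> bracket l f = 0 \<or> bracket l g = 0" if "l \<noteq> 0" for l f g
    using that by (simp add: sq_point_eq mem apolar_mul2)
  have int: "L (mul2 f g) \<inter> conic = {sq_point f, sq_point g}" if "f \<noteq> 0" "g \<noteq> 0" for f g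
  proof -
    have "sq_point f \<in> L (mul2 f g)" "sq_point g \<in> L (mul2 f g)"
      using that by (simp_all add: sq) (simp_all add: bracket_def)
    moreover have "sq_point f \<in> conic" "sq_point g \<in> conic" using that by (auto simp: conic_def)
    moreover have "p \<in> {sq_point f, sq_point g}" if p: "p \<in> L (mul2 f g) \<inter> conic" for p
    proof -
      obtain l where l: "l \<noteq> 0" "p = sq_point l" using p unfolding conic_def by blast
      then have "bracket l f = 0 \<or> bracket l g = 0" using p sq by auto
      then show ?thesis using sq_point_eqI l \<open>f \<noteq> 0\<close> \<open>g \<noteq> 0\<close> by blast
    qed
    ultimately show ?thesis by blast
  qed
  have L_ne: "L (mul2 a b) \<noteq> L (mul2 d e)"
  proof -
    have "sq_point a \<in> L (mul2 a b)" using sq[OF nz(1), of a b] by (simp add: bracket_def)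
    moreover have "sq_point a \<notin> L (mul2 d e)" using sq[OF nz(1), of d e] bracket by simp
    ultimately show ?thesis by blast
  qed
  have L_line: "L (mul2 f g) \<in> proj_lines" if "f \<noteq> 0" "g \<noteq> 0" for f g
    unfolding L_def using that by (intro apolar_line) simp
  have M: "L (mul2 c c) = proj_tangent conic (sq_point c)"
    unfolding L_def using proj_tangent_conic[OF nz(5)] by simp
  have "sq_point c \<in> L (mul2 c c)" using sq[OF nz(5), of c c] by (simp add: bracket_def)
  then have "\<exists>M\<in>proj_lines. sq_point c \<in> M \<and> z \<in> M \<and> M = proj_tangent conic (sq_point c)"
    using L_line[OF nz(5,5)] zL(3) M by (intro bexI[of _ "L (mul2 c c)"] conjI)
  moreover have "\<exists>L1\<in>proj_lines. \<exists>L2\<in>proj_lines. L1 \<noteq> L2 \<and> z \<in> L1 \<and> z \<in> L2 \<and>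
      L1 \<inter> conic = {sq_point a, sq_point b} \<and> L2 \<inter> conic = {sq_point d, sq_point e}"
    using L_ne L_line[OF nz(1,2)] L_line[OF nz(3,4)] zL(1,2) int[OF nz(1,2)] int[OF nz(3,4)]
    by (intro bexI[of _ "L (mul2 a b)"] bexI[of _ "L (mul2 d e)"] conjI)
  moreover have "z \<in> proj_space - conic" using z \<open>z \<notin> conic\<close> by blast
  ultimately have ex: "\<exists>z \<in> proj_space - conic.
      (\<exists>L1\<in>proj_lines. \<exists>L2\<in>proj_lines. L1 \<noteq> L2 \<and> z \<in> L1 \<and> z \<in> L2 \<and>
         L1 \<inter> conic = {sq_point a, sq_point b} \<and> L2 \<inter> conic = {sq_point d, sq_point e}) \<and>
      (\<exists>M\<in>proj_lines. sq_point c \<in> M \<and> z \<in> M \<and> M = proj_tangent conic (sq_point c))"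
    by (intro bexI[of _ z] conjI)
  show ?thesis
    unfolding involution_divisors_def form_point_prod5[symmetric]
    apply (rule CollectI)
    apply (rule exI[of _ a], rule exI[of _ b], rule exI[of _ d], rule exI[of _ e], rule exI[of _ c])
    apply (rule conjI[OF refl])
    apply (rule conjI[OF nz(1)], rule conjI[OF nz(2)], rule conjI[OF nz(3)], rule conjI[OF nz(4)],
      rule conjI[OF nz(5)])
    apply (rule ex)
    done
qed

section \<open>Singularity at the base quintics\<close>

text \<open>A quintic in involution becomes \<open>X (\<alpha> X\<^sup>4 + \<beta> X\<^sup>2 Y\<^sup>2 + \<gamma> Y\<^sup>4)\<close> if \<open>X\<close> and \<open>Y\<close> are the
  linear forms of the two fixed points, with \<open>X\<close> the one that divides it: then the involution is
  \<open>Y \<mapsto> - Y\<close>. The definition asks that \<open>F\<close> vanish on all of these forms, including the degenerate ones.\<close>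
definition kills_involutive :: "(complex^6 \<Rightarrow> complex) \<Rightarrow> bool" where
  "kills_involutive F \<longleftrightarrow> polyfun F \<and>
     (\<forall>A \<alpha> \<beta> \<gamma>. det A \<noteq> 0 \<longrightarrow> F (subst_vars A (vec6 \<alpha> 0 \<beta> 0 \<gamma> 0)) = 0)"

lemma bracket_mult: "bracket (A *v l) (A *v m) = det A * bracket l m"
  by (simp add: bracket_def matrix_vector_mult_def sum_2 det_2) algebra

lemma invol_mult: "invol (A *v c) (A *v d) (A *v e) (A *v f) (A *v g) = det A ^ 3 * invol c d e f g"
  by (simp add: invol_def bracket_mult power3_eq_cube algebra_simps)

text \<open>An even quartic is a product of two even quadratic forms, whose roots are the exchanged pairs.\<close>
lemma even_quartic_factor:
  fixes \<alpha> \<beta> \<gamma> :: complex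
  shows "\<exists>u v u' v'. u * u' = \<alpha> \<and> u * v' + u' * v = \<beta> \<and> v * v' = \<gamma>"
proof (cases "\<alpha> = 0")
  case True
  then show ?thesis
    by (intro exI[of _ 0] exI[of _ 1] exI[of _ \<beta>] exI[of _ \<gamma>]) simp
next
  case False
  define r where "r = (\<beta> + csqrt (\<beta>^2 - 4 * \<alpha> * \<gamma>)) / (2 * \<alpha>)"
  have "2 * \<alpha> * r - \<beta> = csqrt (\<beta>^2 - 4 * \<alpha> * \<gamma>)" using False by (simp add: r_def)
  then have "(2 * \<alpha> * r - \<beta>)^2 = \<beta>^2 - 4 * \<alpha> * \<gamma>" by simp
  then have "4 * \<alpha> * ((\<beta> - \<alpha> * r) * r) = 4 * \<alpha> * \<gamma>" by algebra
  with False have "(\<beta> - \<alpha> * r) * r = \<gamma>" by simp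
  then show ?thesis
    by (intro exI[of _ \<alpha>] exI[of _ "\<beta> - \<alpha> * r"] exI[of _ 1] exI[of _ r]) simp
qed

text \<open>If the two even quadratic factors are independent, then the form is the quintic of an actual divisor. The
  remaining forms are limits of such.\<close>
lemma vanishing_kills:
  assumes "F \<in> vanishing involution_divisors"
  shows "kills_involutive F"
proof -
  have F: "polyfun F" using assms by (auto simp: vanishing_def homogeneous_def)
  have F0: "F (k *s prod5 a b d e c) = 0"
    if "a \<noteq> 0" "b \<noteq> 0" "d \<noteq> 0" "e \<noteq> 0" "c \<noteq> 0" "invol c a b d e = 0"
      "bracket a d \<noteq> 0" "bracket a e \<noteq> 0" "bracket b d \<noteq> 0" "bracket b e \<noteq> 0" for a b d e c k
    using involution_divisorsI[OF that] assms by (auto simp: vanishing_def)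
  have F1: "F (subst_vars A (vec6 (u * u') 0 (u * v' + u' * v) 0 (v * v') 0)) = 0"
    if A: "det A \<noteq> 0" and ne: "u * v' \<noteq> u' * v" for A u v u' v'
  proof -
    define p q p' q' where "p = csqrt u" "q = csqrt (- v)" "p' = csqrt u'" "q' = csqrt (- v')"
    then have sq: "u = p^2" "v = - (q^2)" "u' = p'^2" "v' = - (q'^2)" by simp_all
    define a b d e c :: "complex^2" where "a = vector [p, q]" "b = vector [p, - q]"
      "d = vector [p', q']" "e = vector [p', - q']" "c = vector [1, 0]"
    note defs = this
    have "vec6 (u * u') 0 (u * v' + u' * v) 0 (v * v') 0 = prod5 a b d e c"
      by (rule form_inj) (simp add: form_prod5 form_vec6 form2 defs sq power_numeral_reduce algebra_simps)
    then have eq: "subst_vars A (vec6 (u * u') 0 (u * v' + u' * v) 0 (v * v') 0)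
      = 1 *s prod5 (A *v a) (A *v b) (A *v d) (A *v e) (A *v c)"
      by (simp add: subst_vars_prod5)
    have f: "(p * q' - q * p') * (p * q' + q * p') \<noteq> 0"
    proof
      assume "(p * q' - q * p') * (p * q' + q * p') = 0"
      then have "u * v' = u' * v" unfolding sq by algebra
      with ne show False by simp
    qed
    then have bracket: "bracket a d \<noteq> 0" "bracket a e \<noteq> 0" "bracket b d \<noteq> 0" "bracket b e \<noteq> 0"
    proof -
      have "bracket a d = p * q' - q * p'" "bracket a e = - (p * q' + q * p')"
        "bracket b d = p * q' + q * p'" "bracket b e = - (p * q' - q * p')"
        by (simp_all add: bracket_def defs)
      then show "bracket a d \<noteq> 0" "bracket a e \<noteq> 0" "bracket b d \<noteq> 0" "bracket b e \<noteq> 0"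
        using f by (simp_all only: neg_equal_0_iff_equal mult_eq_0_iff de_Morgan_disj simp_thms)
    qed
    have nz: "A *v l \<noteq> 0" if "bracket l m \<noteq> 0 \<or> bracket m l \<noteq> 0" for l m
    proof
      assume "A *v l = 0"
      then have "det A * bracket l m = 0" "det A * bracket m l = 0" unfolding bracket_mult[symmetric] by (simp_all add: bracket_def)
      with A that show False by simp
    qed
    have "invol c a b d e = 0" by (simp add: invol_def bracket_def defs algebra_simps)
    then have "F (1 *s prod5 (A *v a) (A *v b) (A *v d) (A *v e) (A *v c)) = 0"
      using bracket A
      by (intro F0 nz[of a d] nz[of b d] nz[of d a] nz[of e a] nz[of c "vector [0, 1]"])
        (simp_all add: invol_mult bracket_mult, simp_all add: bracket_def defs)
    with eq show ?thesis by simp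
  qed
  have F2: "F (subst_vars A (vec6 \<alpha> 0 \<beta> 0 \<gamma> 0)) = 0" if A: "det A \<noteq> 0" for A \<alpha> \<beta> \<gamma>
  proof -
    obtain u v u' v' where e: "u * u' = \<alpha>" "u * v' + u' * v = \<beta>" "v * v' = \<gamma>"
      using even_quartic_factor by metis
    define f where "f q r t = F (subst_vars A (vec6 (u * (u' + t * q)) 0 (u * (v' + t * r) + (u' + t * q) * v) 0 (v * (v' + t * r)) 0))"
      for q r t
    have cont: "isCont (f q r) 0" for q r
      unfolding f_def by (intro polyfun_isCont[OF polyfun_subst_vars[OF F]] isCont_vec6 continuous_intros)
    show ?thesis
    proof (cases "u * v' = u' * v")
      case False
      then show ?thesis using F1[OF A False] e by simp
    next
      case True
      consider "u \<noteq> 0" | "v \<noteq> 0" | "u = 0" "v = 0" by blast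
      then show ?thesis
      proof cases
        case 1
        have "f 0 1 t = 0" if "t \<noteq> 0" for t
          unfolding f_def by (rule F1[OF A]) (use True 1 that in \<open>simp add: algebra_simps\<close>)
        then have "f 0 1 0 = 0" by (intro isCont_const_zero[OF cont])
        then show ?thesis using e by (simp add: f_def)
      next
        case 2
        have "f 1 0 t = 0" if "t \<noteq> 0" for t
          unfolding f_def by (rule F1[OF A]) (use True 2 that in \<open>simp add: algebra_simps\<close>)
        then have "f 1 0 0 = 0" by (intro isCont_const_zero[OF cont])
        then show ?thesis using e by (simp add: f_def)
      next
        case 3
        define a d c :: "complex^2" where "a = vector [1, 0]" "d = vector [0, 1]" "c = vector [1, 0]"
        note d = this
        have "F (0 *s prod5 a a d d c) = 0"
          by (rule F0) (auto simp: d invol_def bracket_def vec_eq_iff forall_2)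
        moreover have "subst_vars A (vec6 \<alpha> 0 \<beta> 0 \<gamma> 0) = 0"
          using 3 by (simp flip: e)
        ultimately show ?thesis by simp
      qed
    qed
  qed
  show ?thesis using F F2 by (simp add: kills_involutive_def)
qed

lemma kills_subst_vars:
  assumes "kills_involutive F" "det A \<noteq> 0"
  shows "kills_involutive (\<lambda>v. F (subst_vars A v))"
  using assms by (auto simp: kills_involutive_def subst_vars_compose det_mul intro: polyfun_subst_vars)

text \<open>The class of functions is stable under substitution, so its common singular points form a union of
  orbits.\<close>
lemma subst_vars_singular:
  assumes "\<And>F. kills_involutive F \<Longrightarrow> singular_at F v"
    and F: "kills_involutive F" and A: "det A \<noteq> 0"
  shows "singular_at F (subst_vars A v)"
proof -
  obtain B where "A ** B = mat 1" using A by (metis invertible_det_nz invertible_def)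
  then have "subst_vars A (subst_vars B w) = w" for w by (rule subst_vars_inverse)
  then have "dir_deriv F (subst_vars A v) w = dir_deriv (\<lambda>v. F (subst_vars A v)) v (subst_vars B w)" for w
    by (simp add: dir_deriv_def subst_vars_add subst_vars_scale)
  with assms(1)[OF kills_subst_vars[OF F A]] show ?thesis by (simp add: singular_at_def)
qed

text \<open>The singular points of \<open>F\<close> are closed. This brings in the quintics with a root of multiplicity four or
  five.\<close>
lemma singular_limit:
  fixes \<gamma> :: "complex \<Rightarrow> complex^6"
  assumes "polyfun F" "isCont \<gamma> 0" "\<And>t. t \<noteq> 0 \<Longrightarrow> singular_at F (\<gamma> t)"
  shows "singular_at F (\<gamma> 0)"
  unfolding singular_at_def
proof (intro conjI allI)
  show "F (\<gamma> 0) = 0"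
    by (rule isCont_const_zero[OF polyfun_isCont[OF assms(1,2)]]) (use assms(3) in \<open>simp add: singular_at_def\<close>)
  show "dir_deriv F (\<gamma> 0) w = 0" for w
    by (rule isCont_const_zero[OF dir_deriv_isCont[OF assms(1,2) continuous_const]])
      (use assms(3) in \<open>simp add: singular_at_def\<close>)
qed

lemma tangent_direction:
  assumes "polyfun F" "\<And>t. norm t < 1 \<Longrightarrow> F (v + t *s \<rho> t) = 0" "isCont \<rho> 0"
  shows "dir_deriv F v (\<rho> 0) = 0"
proof (rule secant_limit[of F "\<lambda>t. v" \<rho> 1 1])
  have "F v = 0" using assms(2)[of 0] by simp
  then show "F (v + t ^ 1 *s \<rho> t) = F v" if "norm t < 1" for t using assms(2)[of t] that by simp
qed (use assms in auto)

text \<open>If \<open>F\<close> vanishes on the orbit of \<open>v\<close>, its differential kills the tangent space of the orbit at \<open>v\<close>. Here the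
  tangent vector is \<open>x\<^sub>2 \<partial>v/\<partial>x\<^sub>1\<close>, from the substitution \<open>x\<^sub>1 \<mapsto> x\<^sub>1 + t x\<^sub>2\<close>; it is followed by its counterparts
  \<open>x\<^sub>1 \<partial>v/\<partial>x\<^sub>2\<close> and \<open>x\<^sub>1 \<partial>v/\<partial>x\<^sub>1\<close>.\<close>
lemma kills_x2_d1:
  assumes F: "kills_involutive F" and v: "\<And>A. det A \<noteq> 0 \<Longrightarrow> F (subst_vars A v) = 0"
  shows "dir_deriv F v (vec6 0 (5 * v$1) (4 * v$2) (3 * v$3) (2 * v$4) (v$5)) = 0"
proof -
  define \<rho> where "\<rho> t = vec6 0 (5 * v$1) (10 * t * v$1 + 4 * v$2) (10 * t^2 * v$1 + 6 * t * v$2 + 3 * v$3)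
    (5 * t^3 * v$1 + 4 * t^2 * v$2 + 3 * t * v$3 + 2 * v$4)
    (t^4 * v$1 + t^3 * v$2 + t^2 * v$3 + t * v$4 + v$5)" for t :: complex
  have "v + t *s \<rho> t = subst_vars (mat2 1 t 0 1) v" for t
    by (rule form_inj) (simp add: form_subst_vars form6[of v] mult_mat2 form_add form_scale \<rho>_def form_vec6
        power_numeral_reduce algebra_simps)
  then have "F (v + t *s \<rho> t) = 0" for t by (simp add: v det_mat2)
  moreover have "isCont \<rho> 0" unfolding \<rho>_def by (intro isCont_vec6 continuous_intros)
  moreover have "\<rho> 0 = vec6 0 (5 * v$1) (4 * v$2) (3 * v$3) (2 * v$4) (v$5)" by (simp add: \<rho>_def)
  ultimately show ?thesis using tangent_direction[of F v \<rho>] F by (simp add: kills_involutive_def)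
qed

lemma kills_x1_d2:
  assumes F: "kills_involutive F" and v: "\<And>A. det A \<noteq> 0 \<Longrightarrow> F (subst_vars A v) = 0"
  shows "dir_deriv F v (vec6 (v$2) (2 * v$3) (3 * v$4) (4 * v$5) (5 * v$6) 0) = 0"
proof -
  define \<rho> where "\<rho> t = vec6 (t^4 * v$6 + t^3 * v$5 + t^2 * v$4 + t * v$3 + v$2)
    (5 * t^3 * v$6 + 4 * t^2 * v$5 + 3 * t * v$4 + 2 * v$3)
    (10 * t^2 * v$6 + 6 * t * v$5 + 3 * v$4) (10 * t * v$6 + 4 * v$5) (5 * v$6) 0" for t :: complex
  have "v + t *s \<rho> t = subst_vars (mat2 1 0 t 1) v" for t
    by (rule form_inj) (simp add: form_subst_vars form6[of v] mult_mat2 form_add form_scale \<rho>_def form_vec6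
        power_numeral_reduce algebra_simps)
  then have "F (v + t *s \<rho> t) = 0" for t by (simp add: v det_mat2)
  moreover have "isCont \<rho> 0" unfolding \<rho>_def by (intro isCont_vec6 continuous_intros)
  moreover have "\<rho> 0 = vec6 (v$2) (2 * v$3) (3 * v$4) (4 * v$5) (5 * v$6) 0" by (simp add: \<rho>_def)
  ultimately show ?thesis using tangent_direction[of F v \<rho>] F by (simp add: kills_involutive_def)
qed

lemma kills_x1_d1:
  assumes F: "kills_involutive F" and v: "\<And>A. det A \<noteq> 0 \<Longrightarrow> F (subst_vars A v) = 0"
  shows "dir_deriv F v (vec6 (5 * v$1) (4 * v$2) (3 * v$3) (2 * v$4) (v$5) 0) = 0"
proof -
  define \<rho> where "\<rho> t = vec6 ((5 + 10 * t + 10 * t^2 + 5 * t^3 + t^4) * v$1) ((4 + 6 * t + 4 * t^2 + t^3) * v$2)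
    ((3 + 3 * t + t^2) * v$3) ((2 + t) * v$4) (v$5) 0" for t :: complex
  have "v + t *s \<rho> t = subst_vars (mat2 (1 + t) 0 0 1) v" for t
    by (simp add: subst_vars_diag vec6_eq_iff \<rho>_def power_numeral_reduce algebra_simps)
  moreover have "1 + t \<noteq> 0" if "norm t < 1" for t :: complex
  proof
    assume "1 + t = 0"
    then have "t = -1" by (simp add: eq_neg_iff_add_eq_0 add.commute)
    with that show False by simp
  qed
  ultimately have "F (v + t *s \<rho> t) = 0" if "norm t < 1" for t using that by (simp add: v det_mat2)
  moreover have "isCont \<rho> 0" unfolding \<rho>_def by (intro isCont_vec6 continuous_intros)
  moreover have "\<rho> 0 = vec6 (5 * v$1) (4 * v$2) (3 * v$3) (2 * v$4) (v$5) 0" by (simp add: \<rho>_def)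
  ultimately show ?thesis using tangent_direction[of F v \<rho>] F by (simp add: kills_involutive_def)
qed

lemma tangent_line:
  assumes "kills_involutive F" "\<And>t. F (v + t *s w) = 0"
  shows "dir_deriv F v w = 0"
  using tangent_direction[of F v "\<lambda>t. w"] assms by (simp add: kills_involutive_def)

text \<open>The exchange of \<open>x\<^sub>1\<close> and \<open>x\<^sub>2\<close> is an involution with fixed points \<open>x\<^sub>1 + x\<^sub>2\<close> and \<open>x\<^sub>1 - x\<^sub>2\<close>. A
  palindromic quintic is an even quartic in these two forms times the first of them, an antipalindromic one is
  an even quartic times the second.\<close>
lemma kills_palindromic:
  assumes F: "kills_involutive F" and A: "det A \<noteq> 0"
  shows "F (subst_vars A (vec6 a b c c b a)) = 0" "F (subst_vars A (vec6 a b c (- c) (- b) (- a))) = 0"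
proof -
  have pal: "vec6 a b c c b a = subst_vars (mat2 1 1 1 (-1))
      (vec6 ((a + b + c) / 16) 0 ((10 * a + 2 * b - 2 * c) / 16) 0 ((5 * a - 3 * b + c) / 16) 0)" for a b c
    by (rule form_inj) (simp add: form_subst_vars mult_mat2 form_vec6 power_numeral_reduce field_simps)
  have 1: "F (subst_vars A (vec6 a b c c b a)) = 0" if "det A \<noteq> 0" for A a b c
  proof -
    have "det (A ** mat2 1 1 1 (-1)) \<noteq> 0" using that by (simp add: det_mul det_mat2)
    then show ?thesis using F unfolding pal subst_vars_compose kills_involutive_def by blast
  qed
  show "F (subst_vars A (vec6 a b c c b a)) = 0" using 1[OF A] .
  have "vec6 a b c (- c) (- b) (- a) = subst_vars (mat2 1 0 0 (-1)) (vec6 a (- b) c c (- b) a)"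
    by (rule form_inj) (simp add: form_subst_vars mult_mat2 form_vec6)
  moreover have "det (A ** mat2 1 0 0 (-1)) \<noteq> 0" using A by (simp add: det_mul det_mat2)
  ultimately show "F (subst_vars A (vec6 a b c (- c) (- b) (- a))) = 0"
    using 1 by (simp add: subst_vars_compose)
qed

lemma nontrivial_root_of_unity:
  assumes "n \<ge> 2"
  obtains z :: complex where "z ^ n = 1" "z \<noteq> 1"
proof -
  have "card {z::complex. z ^ n = 1} = n" using assms by (intro card_roots_unity_eq) simp
  then have "\<not> {z::complex. z ^ n = 1} \<subseteq> {1}" using assms card_mono[of "{1::complex}" "{z. z ^ n = 1}"] by auto
  then show ?thesis using that by blast
qed

text \<open>The form \<open>x\<^sub>1\<^sup>5 + x\<^sub>2\<^sup>5\<close> has five involutions, permuted by \<open>x\<^sub>1 \<mapsto> z x\<^sub>1\<close>, \<open>z\<^sup>5 = 1\<close>, so five branches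
  of the hypersurface meet there. Together, the orbit directions and the palindromic directions make up the tangent
  hyperplane of one branch; a rotated branch has a different one.\<close>
lemma singular_U1:
  assumes F: "kills_involutive F"
  shows "singular_at F (vec6 1 0 0 0 0 1)"
proof -
  let ?v = "vec6 1 0 0 0 0 1 :: complex^6"
  have pF: "polyfun F" using F by (simp add: kills_involutive_def)
  have 0: "F (subst_vars A ?v) = 0" if "det A \<noteq> 0" for A
    using kills_palindromic(1)[OF F that, of 1 0 0] by simp
  have 1: "dir_deriv F ?v (vec6 a b c c b a) = 0" for a b c
  proof (rule tangent_line[OF F])
    show "F (?v + t *s vec6 a b c c b a) = 0" for t
      using kills_palindromic(1)[OF F, of "mat 1" "1 + t * a" "t * b" "t * c"]
      by (simp add: det_I vec6_add vec6_scale)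
  qed
  obtain z :: complex where z: "z ^ 5 = 1" "z \<noteq> 1" using nontrivial_root_of_unity[of 5] by auto
  have z0: "z \<noteq> 0" using z by auto
  have 2: "dir_deriv F ?v (vec6 0 0 (z^3) (z^2) 0 0) = 0"
  proof (rule tangent_line[OF F])
    show "F (?v + t *s vec6 0 0 (z^3) (z^2) 0 0) = 0" for t
      using kills_palindromic(1)[OF F, of "mat2 z 0 0 1" 1 0 t] z z0
      by (simp add: det_mat2 vec6_add vec6_scale subst_vars_diag mult.commute)
  qed
  obtain D1 D2 D3 D4 D5 D6 where D: "\<And>a b c d e f. dir_deriv F ?v (vec6 a b c d e f)
      = a * D1 + b * D2 + c * D3 + d * D4 + e * D5 + f * D6"
    by (rule dir_deriv_vec6[OF pF, of ?v]) (rule that)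
  have "D1 = 0" "D2 = 0" "D5 = 0"
    using kills_x1_d1[OF F 0] kills_x2_d1[OF F 0] kills_x1_d2[OF F 0] by (simp_all add: D)
  moreover from this have "D6 = 0" using 1[of 1 0 0] by (simp add: D)
  moreover have D34: "D3 + D4 = 0" using 1[of 0 0 1] by (simp add: D)
  then have "(z^2 * (z - 1)) * D3 = 0" using 2 unfolding D by algebra
  then have "D3 = 0" using z z0 by simp
  moreover have "D4 = 0" using D34 \<open>D3 = 0\<close> by simp
  moreover have "F ?v = 0" using 0[of "mat 1"] by (simp add: det_I)
  ultimately show ?thesis by (intro singular_atI[OF D])
qed

text \<open>As for \<open>x\<^sub>1\<^sup>5 + x\<^sub>2\<^sup>5\<close>, with the three involutions of \<open>x\<^sub>1x\<^sub>2(x\<^sub>1\<^sup>3 - x\<^sub>2\<^sup>3)\<close>.\<close>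
lemma singular_U2:
  assumes F: "kills_involutive F"
  shows "singular_at F (vec6 0 1 0 0 (-1) 0)"
proof -
  let ?v = "vec6 0 1 0 0 (-1) 0 :: complex^6"
  have pF: "polyfun F" using F by (simp add: kills_involutive_def)
  have 0: "F (subst_vars A ?v) = 0" if "det A \<noteq> 0" for A
    using kills_palindromic(2)[OF F that, of 0 1 0] by simp
  have 1: "dir_deriv F ?v (vec6 0 0 1 (-1) 0 0) = 0"
  proof (rule tangent_line[OF F])
    show "F (?v + t *s vec6 0 0 1 (-1) 0 0) = 0" for t
      using kills_palindromic(2)[OF F, of "mat 1" 0 1 t]
      by (simp add: det_I vec6_add vec6_scale)
  qed
  obtain z :: complex where z: "z ^ 3 = 1" "z \<noteq> 1" using nontrivial_root_of_unity[of 3] by auto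
  have z0: "z \<noteq> 0" using z by auto
  have 2: "dir_deriv F ?v (vec6 0 0 z (- (z^2)) 0 0) = 0"
  proof (rule tangent_line[OF F])
    have "z^4 * z^2 = 1" "z * (z^2)^4 = 1" "z^3 * (z^2)^2 = z" "z^2 * (z^2)^3 = z^2"
      using z(1) by algebra+
    then show "F (?v + t *s vec6 0 0 z (- (z^2)) 0 0) = 0" for t
      using kills_palindromic(2)[OF F, of "mat2 z 0 0 (z^2)" 0 1 t] z0
      by (simp add: det_mat2 vec6_add vec6_scale subst_vars_diag mult.commute)
  qed
  obtain D1 D2 D3 D4 D5 D6 where D: "\<And>a b c d e f. dir_deriv F ?v (vec6 a b c d e f)
      = a * D1 + b * D2 + c * D3 + d * D4 + e * D5 + f * D6"
    by (rule dir_deriv_vec6[OF pF, of ?v]) (rule that)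
  have "dir_deriv F ?v ?v = 0"
  proof (rule tangent_line[OF F])
    show "F (?v + t *s ?v) = 0" for t
      using kills_palindromic(2)[OF F, of "mat 1" 0 "1 + t" 0]
      by (simp add: det_I vec6_add vec6_scale)
  qed
  then have "D2 = 0 \<and> D5 = 0"
    using kills_x1_d1[OF F 0] by (simp add: D)
  have "D3 = D4" using 1 by (simp add: D)
  then have "(z * (z - 1)) * D3 = 0" using 2 by (simp add: D power2_eq_square algebra_simps)
  then have "D3 = 0" using z z0 by simp
  moreover have "D4 = 0" using \<open>D3 = D4\<close> \<open>D3 = 0\<close> by simp
  moreover have "D6 = 0" using kills_x2_d1[OF F 0] \<open>D3 = 0\<close> by (simp add: D)
  moreover have "D1 = 0" using kills_x1_d2[OF F 0] \<open>D4 = 0\<close> by (simp add: D)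
  moreover have "F ?v = 0" using 0[of "mat 1"] by (simp add: det_I)
  ultimately show ?thesis using \<open>D2 = 0 \<and> D5 = 0\<close> by (intro singular_atI[OF D]) simp_all
qed

lemma subst_vars_even: "subst_vars (mat2 1 m n 1) (vec6 A 0 B 0 C 0) = vec6
   (A + B * n^2 + C * n^4)
   (5 * A * m + B * (2 * n + 3 * m * n^2) + C * (4 * n^3 + m * n^4))
   (10 * A * m^2 + B * (1 + 6 * m * n + 3 * m^2 * n^2) + C * (6 * n^2 + 4 * m * n^3))
   (10 * A * m^3 + B * (3 * m + 6 * m^2 * n + m^3 * n^2) + C * (4 * n + 6 * m * n^2))
   (5 * A * m^4 + B * (3 * m^2 + 2 * m^3 * n) + C * (1 + 4 * m * n))
   (A * m^5 + B * m^3 + C * m)"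
  by (rule form_inj) (simp add: form_subst_vars mult_mat2 form_vec6 power_numeral_reduce algebra_simps)

text \<open>The form is \<open>x\<^sub>1\<^sup>3 (s x\<^sub>1\<^sup>2 + x\<^sub>2\<^sup>2)\<close>. The parameters of the even quartic and the orbit directions
  give all tangent directions except \<open>x\<^sub>2\<^sup>5\<close>. That one is obtained as a
  limit of chords between two families through this point. In the family \<open>\<gamma>\<close> one of the three roots
  near the triple root is fixed, and each of the other two is exchanged with a root of \<open>s x\<^sub>1\<^sup>2 + x\<^sub>2\<^sup>2\<close> (for \<open>s = 0\<close>
  this is \<open>x\<^sub>1(x\<^sub>1 + t x\<^sub>2)\<^sup>2x\<^sub>2\<^sup>2\<close>). In the family \<open>\<gamma> + t\<^sup>3\<rho>\<close> one is fixed and the other two are exchanged.\<close>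
lemma singular_triple_root:
  assumes F: "kills_involutive F"
  shows "singular_at F (vec6 s 0 1 0 0 0)"
proof -
  let ?v = "vec6 s 0 1 0 0 0 :: complex^6"
  have pF: "polyfun F" using F by (simp add: kills_involutive_def)
  have even: "F (vec6 a 0 b 0 c 0) = 0" for a b c
  proof -
    have "F (subst_vars (mat 1) (vec6 a 0 b 0 c 0)) = 0"
      using F unfolding kills_involutive_def by (metis det_I zero_neq_one)
    then show ?thesis by simp
  qed
  have 0: "F (subst_vars A ?v) = 0" if "det A \<noteq> 0" for A
    using F that unfolding kills_involutive_def by blast
  have 1: "dir_deriv F ?v (vec6 a 0 b 0 c 0) = 0" for a b c
    by (rule tangent_line[OF F]) (simp add: vec6_add vec6_scale even)
  obtain D1 D2 D3 D4 D5 D6 where D: "\<And>a b c d e f. dir_deriv F ?v (vec6 a b c d e f)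
      = a * D1 + b * D2 + c * D3 + d * D4 + e * D5 + f * D6"
    by (rule dir_deriv_vec6[OF pF, of ?v]) (rule that)
  have D0: "D1 = 0" "D3 = 0" "D5 = 0" using 1[of 1 0 0] 1[of 0 1 0] 1[of 0 0 1] by (simp_all add: D)
  moreover have "D2 = 0" using kills_x1_d2[OF F 0] by (simp add: D)
  moreover have "D4 = 0" using kills_x2_d1[OF F 0] \<open>D2 = 0\<close> by (simp add: D)
  moreover have "D6 = 0"
  proof -
    \<comment> \<open>The second family is \<open>A X\<^sup>5 + B X\<^sup>3Y\<^sup>2 + C X Y\<^sup>4\<close> with \<open>X = x\<^sub>1 + \<mu> t x\<^sub>2\<close>, \<open>Y = \<nu> t x\<^sub>1 + x\<^sub>2\<close>, \<open>A = s - \<nu>\<^sup>2t\<^sup>2\<close>,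
      \<open>B = 1 + b t\<^sup>2\<close>, \<open>C = - t\<^sup>2 / 3\<close>. The numbers \<open>\<mu>, \<nu>, b\<close> are chosen
      so that the two families agree up to \<open>O(t\<^sup>3)\<close>.\<close>
    define \<mu> \<nu> b :: complex where "\<mu> = 2 / 3" "\<nu> = - 5 * s / 3" "b = 20 * s / 9"
    note par = this
    define \<gamma> where "\<gamma> t = vec6 s 0 1 (2 * t) (t^2) 0" for t :: complex
    define \<rho> where "\<rho> t = vec6 (b * \<nu>^2 * t - \<nu>^4 * t^3 / 3)
      (2 * b * \<nu> - 2 * \<mu> * \<nu>^2 + (3 * b * \<mu> * \<nu>^2 - 4 * \<nu>^3 / 3) * t^2 - \<mu> * \<nu>^4 * t^4 / 3)
      ((- 10 * \<nu>^2 * \<mu>^2 + 6 * b * \<mu> * \<nu> + 3 * \<mu>^2 * \<nu>^2 - 2 * \<nu>^2) * t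
        + (3 * b * \<mu>^2 * \<nu>^2 - 4 * \<mu> * \<nu>^3 / 3) * t^3)
      (10 * s * \<mu>^3 + 6 * \<mu>^2 * \<nu> + 3 * b * \<mu> - 4 * \<nu> / 3
        + (- 10 * \<nu>^2 * \<mu>^3 + 6 * b * \<mu>^2 * \<nu> + \<mu>^3 * \<nu>^2 - 2 * \<mu> * \<nu>^2) * t^2 + b * \<mu>^3 * \<nu>^2 * t^4)
      ((5 * s * \<mu>^4 + 3 * b * \<mu>^2 + 2 * \<mu>^3 * \<nu> - 4 * \<mu> * \<nu> / 3) * t
        + (- 5 * \<nu>^2 * \<mu>^4 + 2 * b * \<mu>^3 * \<nu>) * t^3)
      (2 / 27 + (s * \<mu>^5 + b * \<mu>^3) * t^2 - \<nu>^2 * \<mu>^5 * t^4)" for t :: complex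
    have "F (\<gamma> t) = 0" if "t \<noteq> 0" for t
    proof -
      \<comment> \<open>the involution fixes \<open>x\<^sub>1\<close> and \<open>x\<^sub>1 + 2 t x\<^sub>2\<close>\<close>
      have "\<gamma> t = subst_vars (mat2 1 0 1 (2 * t))
          (vec6 (s + 1 / (16 * t^2)) 0 (- 1 / (8 * t^2)) 0 (1 / (16 * t^2)) 0)"
        using that by (intro form_inj)
          (simp add: form_subst_vars mult_mat2 form_vec6 \<gamma>_def power_numeral_reduce field_simps)
      then show ?thesis using F that unfolding kills_involutive_def by (simp add: det_mat2)
    qed
    moreover have "F (\<gamma> t + t^3 *s \<rho> t) = 0" if "det (mat2 1 (\<mu> * t) (\<nu> * t) 1) \<noteq> 0" for t
    proof -
      have "\<gamma> t + t^3 *s \<rho> t = subst_vars (mat2 1 (\<mu> * t) (\<nu> * t) 1)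
          (vec6 (s - \<nu>^2 * t^2) 0 (1 + b * t^2) 0 (- (t^2) / 3) 0)"
        unfolding subst_vars_even vec6_eq_iff \<gamma>_def \<rho>_def par
        by (intro conjI) (simp_all add: field_simps power_numeral_reduce)
      then show ?thesis using F that unfolding kills_involutive_def by simp
    qed
    moreover have "det (mat2 1 (\<mu> * t) (\<nu> * t) 1) \<noteq> 0" if "norm t < 1 / (1 + norm (\<mu> * \<nu>))" for t
    proof
      define k where "k = norm (\<mu> * \<nu>)"
      have k: "k \<ge> 0" by (simp add: k_def)
      assume "det (mat2 1 (\<mu> * t) (\<nu> * t) 1) = 0"
      then have "(\<mu> * \<nu>) * t^2 = 1" by (simp add: det_mat2 power2_eq_square algebra_simps)
      then have 1: "k * norm t ^ 2 = 1"
        unfolding k_def norm_power[symmetric] norm_mult[symmetric] by simp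
      have t: "norm t * (1 + k) < 1" using that k by (simp add: pos_less_divide_eq flip: k_def)
      moreover have "norm t \<le> norm t * (1 + k)" using k by (simp add: algebra_simps)
      ultimately have "norm t < 1" by simp
      then have "norm t ^ 2 \<le> norm t" by (simp add: power2_eq_square mult_left_le)
      then have "k * norm t ^ 2 \<le> k * norm t" using k by (simp add: mult_left_mono)
      also have "\<dots> \<le> norm t * (1 + k)" by (simp add: algebra_simps)
      finally show False using 1 t by simp
    qed
    moreover have "0 < 1 / (1 + norm (\<mu> * \<nu>))" using norm_ge_zero[of "\<mu> * \<nu>"] by (simp add: add_pos_nonneg)
    moreover have "isCont \<gamma> 0" "isCont \<rho> 0"
      unfolding \<gamma>_def \<rho>_def by (intro isCont_vec6 continuous_intros; simp)+
    ultimately have "dir_deriv F (\<gamma> 0) (\<rho> 0) = 0"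
      using pF by (intro secant_limit[where n = 3 and r = "1 / (1 + norm (\<mu> * \<nu>))"]) simp_all
    moreover have "\<gamma> 0 = ?v" by (simp add: \<gamma>_def)
    moreover have "\<rho> 0 $ 6 = 2 / 27" by (simp add: \<rho>_def)
    ultimately show "D6 = 0"
      using D0 \<open>D2 = 0\<close> \<open>D4 = 0\<close> unfolding \<rho>_def by (simp add: D)
  qed
  moreover have "F ?v = 0" by (rule even)
  ultimately show ?thesis by (intro singular_atI[OF D])
qed

text \<open>The form is \<open>x\<^sub>1\<^sup>3 x\<^sub>2 (x\<^sub>1 + s x\<^sub>2)\<close>. For \<open>s \<noteq> 0\<close>, completing the square in the quadratic factor leads back to
  \<open>singular_triple_root\<close>.\<close>
lemma singular_triple_root':
  assumes F: "kills_involutive F"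
  shows "singular_at F (vec6 0 1 s 0 0 0)"
proof -
  have nz: "singular_at F (vec6 0 1 s 0 0 0)" if "s \<noteq> 0" for s
  proof -
    define \<kappa> where "\<kappa> = csqrt s"
    then have k: "s = \<kappa>^2" "\<kappa> \<noteq> 0" using that by auto
    have "vec6 0 1 s 0 0 0 = subst_vars (mat2 1 0 (\<kappa> / (2 * s)) \<kappa>) (vec6 (- 1 / (4 * s)) 0 1 0 0 0)"
      using k(2) unfolding k(1) by (intro form_inj)
        (simp add: form_subst_vars mult_mat2 form_vec6 power_numeral_reduce field_simps)
    then show ?thesis
      using subst_vars_singular[OF singular_triple_root F] k(2) by (simp add: det_mat2)
  qed
  show ?thesis
  proof (cases "s = 0")
    case True
    have "singular_at F (vec6 0 1 0 0 0 0)"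
      by (rule singular_limit[where \<gamma> = "\<lambda>t. vec6 0 1 t 0 0 0"])
        (use F nz in \<open>auto simp: kills_involutive_def intro!: isCont_vec6 continuous_intros\<close>)
    with True show ?thesis by simp
  qed (rule nz)
qed

lemma singular_U6:
  assumes F: "kills_involutive F"
  shows "singular_at F (vec6 1 0 0 0 0 0)"
proof -
  have nz: "singular_at F (vec6 1 0 s 0 0 0)" if "s \<noteq> 0" for s
  proof -
    have "vec6 1 0 s 0 0 0 = subst_vars (mat2 1 0 0 (csqrt s)) (vec6 1 0 1 0 0 0)"
      by (simp add: subst_vars_diag)
    then show ?thesis
      using subst_vars_singular[OF singular_triple_root F, of "mat2 1 0 0 (csqrt s)"] that by (simp add: det_mat2)
  qed
  show ?thesis
    by (rule singular_limit[where \<gamma> = "\<lambda>t. vec6 1 0 t 0 0 0"])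
      (use F nz in \<open>auto simp: kills_involutive_def intro!: isCont_vec6 continuous_intros\<close>)
qed

definition base_quintics :: "(complex^6) set" where
  "base_quintics = {vec6 1 0 0 0 0 1, vec6 0 1 0 0 (-1) 0, vec6 0 1 1 0 0 0, vec6 0 0 1 0 0 0,
     vec6 0 1 0 0 0 0, vec6 1 0 0 0 0 0}"

lemma base_quintic_singular:
  assumes "u \<in> base_quintics" "kills_involutive F"
  shows "singular_at F u"
  using assms singular_U1 singular_U2 singular_triple_root'[of F] singular_triple_root[of F 0] singular_U6
  unfolding base_quintics_def by auto

lemma base_quintic_forms:
  "{U1, U2, U3, U4, U5, U6} = form ` base_quintics"
proof -
  have "U1 = form (vec6 1 0 0 0 0 1)" "U2 = form (vec6 0 1 0 0 (-1) 0)" "U3 = form (vec6 0 1 1 0 0 0)"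
    "U4 = form (vec6 0 0 1 0 0 0)" "U5 = form (vec6 0 1 0 0 0 0)" "U6 = form (vec6 1 0 0 0 0 0)"
    by (simp_all add: fun_eq_iff U1_def U2_def U3_def U4_def U5_def U6_def form_vec6 algebra_simps power_numeral_reduce)
  then show ?thesis by (simp add: base_quintics_def)
qed

lemma complex_root:
  assumes "n > 0"
  obtains z :: complex where "z ^ n = w"
proof (cases "w = 0")
  case True
  with assms that[of 0] show ?thesis by (simp add: zero_power)
next
  case False
  have "exp (Ln w / of_nat n) ^ n = w"
    using assms False by (simp flip: exp_of_nat_mult)
  then show ?thesis by (rule that)
qed

lemma sl2_orbit_form: "sl2_orbit (form u) = {range (\<lambda>k. k *s subst_vars A u) |A. det A = 1}" for u :: "complex^6"
proof -
  have "sl2_act A (form u) = form (subst_vars A u)" for A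
    by (simp add: sl2_act_def form_subst_vars fun_eq_iff)
  then show ?thesis by (simp add: sl2_orbit_def form_point_eq6)
qed

lemma involution_divisors_proj: "involution_divisors \<subseteq> proj_space"
proof
  fix p assume "p \<in> involution_divisors"
  then show "p \<in> proj_space"
    by (rule involution_divisorsD) (simp add: proj_space_range prod5_nonzero)
qed

lemma vanishing_hypersurface: "vanishing involution_hypersurface = vanishing involution_divisors"
proof -
  have "involution_divisors \<subseteq> involution_hypersurface"
    using involution_divisors_proj
    unfolding involution_hypersurface_def zariski_closure_def vanishing_def by blast
  then show ?thesis
    unfolding involution_hypersurface_def zariski_closure_def vanishing_def by blast
qed

text \<open>The definition of singularity refers to all nonzero representatives \<open>k *s v\<close> of the point. The ideal of the
  closure is the ideal of the divisors in involution.\<close>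
lemma hypersurface_sing_iff:
  fixes v :: "complex^6"
  assumes "v \<noteq> 0"
  shows "range (\<lambda>k. k *s v) \<in> hypersurface_sing involution_hypersurface \<longleftrightarrow>
    (\<forall>F\<in>vanishing involution_divisors. \<forall>k. k \<noteq> 0 \<longrightarrow> singular_at F (k *s v))"
    (is "?p \<in> _ \<longleftrightarrow> ?R")
proof
  assume p: "?p \<in> hypersurface_sing involution_hypersurface"
  show ?R
  proof (intro ballI allI impI)
    fix F k assume F: "F \<in> vanishing involution_divisors" and k: "k \<noteq> (0::complex)"
    have "F (k *s v) = 0"
      using p F unfolding hypersurface_sing_def involution_hypersurface_def zariski_closure_def by blast
    moreover have "dir_deriv F (k *s v) w = 0" for w
    proof (cases "w = 0")
      case True
      have "polyfun F" using F by (auto simp: vanishing_def homogeneous_def)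
      from dir_deriv_linear(2)[OF this, of _ 0 0] True show ?thesis by simp
    next
      case False
      then have "range (\<lambda>k. k *s w) \<in> proj_tangent involution_hypersurface ?p"
        using p proj_space_range by (simp add: hypersurface_sing_def)
      moreover have "k *s v \<in> ?p - {0}" using k assms by auto
      ultimately show ?thesis
        using F self_in_range_scale[of w]
        unfolding proj_tangent_def vanishing_hypersurface dir_deriv_def by blast
    qed
    ultimately show "singular_at F (k *s v)" by (simp add: singular_at_def)
  qed
next
  assume R: ?R
  have "F (k *s v) = 0" if F: "F \<in> vanishing involution_divisors" for F k
  proof (cases "k = 0")
    case True
    have "F (subst_vars (mat 1) (vec6 0 0 0 0 0 0)) = 0"
      using vanishing_kills[OF F] unfolding kills_involutive_def by (metis det_I zero_neq_one)
    with True show ?thesis by simp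
  qed (use R F in \<open>auto simp: singular_at_def\<close>)
  then have "?p \<in> involution_hypersurface"
    using proj_space_range[OF assms] unfolding involution_hypersurface_def zariski_closure_def by auto
  moreover have "proj_tangent involution_hypersurface ?p = proj_space"
    using R unfolding proj_tangent_def vanishing_hypersurface singular_at_def dir_deriv_def by auto
  ultimately show "?p \<in> hypersurface_sing involution_hypersurface"
    by (simp add: hypersurface_sing_def)
qed

text \<open>All multiples of a point of the orbit of \<open>u\<close> are images of \<open>u\<close> under substitutions, by scalar
  matrices with a fifth root as entry.\<close>
lemma orbit_singular:
  assumes u: "u \<in> base_quintics" and A: "det A = 1"
  shows "range (\<lambda>k. k *s subst_vars A u) \<in> hypersurface_sing involution_hypersurface"
proof -
  obtain B where B: "A ** B = mat 1" using A by (metis invertible_det_nz invertible_def zero_neq_one)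
  have "u \<noteq> 0" using u by (auto simp: base_quintics_def vec6_eq_iff)
  then have "subst_vars A u \<noteq> 0" using subst_vars_inverse(2)[OF B, of u] by auto
  moreover have "singular_at F (k *s subst_vars A u)" if F: "F \<in> vanishing involution_divisors" and k: "k \<noteq> 0" for F k
  proof -
    obtain r where r: "r ^ 5 = k" using complex_root[of 5] by auto
    have "subst_vars (mat2 r 0 0 r) u = k *s u"
      unfolding r[symmetric] by (simp add: subst_vars_diag vec6_eq_iff power_numeral_reduce)
    then have "k *s subst_vars A u = subst_vars (A ** mat2 r 0 0 r) u"
      by (simp add: subst_vars_scale flip: subst_vars_compose)
    moreover have "det (A ** mat2 r 0 0 r) \<noteq> 0"
      using A r k by (auto simp: det_mul det_mat2)
    ultimately show ?thesis
      using subst_vars_singular[OF base_quintic_singular[OF u] vanishing_kills[OF F]] by simp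
  qed
  ultimately show ?thesis by (simp add: hypersurface_sing_iff)
qed

section \<open>The involution invariant\<close>

text \<open>\<open>invol\<close> for the linear forms \<open>x\<^sub>1 - y x\<^sub>2\<close> with roots \<open>y\<close>.\<close>
definition invol_aff :: "complex \<Rightarrow> complex \<Rightarrow> complex \<Rightarrow> complex \<Rightarrow> complex \<Rightarrow> complex" where
  "invol_aff c d e f g = (d - c) * (f - c) * (g - e) + (e - c) * (g - c) * (f - d)"

text \<open>The product over the three ways to split the last four roots into two pairs.\<close>
definition invol_aff3 :: "complex \<Rightarrow> complex \<Rightarrow> complex \<Rightarrow> complex \<Rightarrow> complex \<Rightarrow> complex" where
  "invol_aff3 c d e f g = invol_aff c d e f g * invol_aff c d f e g * invol_aff c d g e f"

text \<open>The product over all fifteen choices of a fixed root and two exchanged pairs.\<close>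
definition invol_prod :: "complex \<Rightarrow> complex \<Rightarrow> complex \<Rightarrow> complex \<Rightarrow> complex \<Rightarrow> complex" where
  "invol_prod a b c d e = invol_aff3 a b c d e * invol_aff3 b a c d e * invol_aff3 c a b d e * invol_aff3 d a b c e * invol_aff3 e a b c d"

text \<open>The numbers \<open>a, \<dots>, e\<close> are the roots of the form \<open>v\<close>, dehomogenised at \<open>x\<^sub>2 = 1\<close>, times the leading
  coefficient \<open>v $ 1\<close>. Unlike the roots themselves they are roots of a monic polynomial with coefficients
  polynomial in \<open>v\<close>, and exist even if \<open>v $ 1 = 0\<close>.\<close>
definition scaled_roots :: "complex^6 \<Rightarrow> complex \<Rightarrow> complex \<Rightarrow> complex \<Rightarrow> complex \<Rightarrow> complex \<Rightarrow> bool" where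
  "scaled_roots v a b c d e \<longleftrightarrow>
     [:v$1^4 * v$6, v$1^3 * v$5, v$1^2 * v$4, v$1 * v$3, v$2, 1:] = [:-a, 1:] * [:-b, 1:] * [:-c, 1:] * [:-d, 1:] * [:-e, 1:]"

lemma scaled_roots_iff: "scaled_roots v a b c d e \<longleftrightarrow>
   v$2 = - (a + b + c + d + e) \<and>
   v$1 * v$3 = a*b + a*c + a*d + a*e + b*c + b*d + b*e + c*d + c*e + d*e \<and>
   v$1^2 * v$4 = - (a*b*c + a*b*d + a*b*e + a*c*d + a*c*e + a*d*e + b*c*d + b*c*e + b*d*e + c*d*e) \<and>
   v$1^3 * v$5 = a*b*c*d + a*b*c*e + a*b*d*e + a*c*d*e + b*c*d*e \<and>
   v$1^4 * v$6 = - (a*b*c*d*e)"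
  unfolding scaled_roots_def by (simp add: algebra_simps) (auto simp: algebra_simps)

lemma monic_quintic_splits:
  obtains a b c d e :: complex where
    "[:c0, c1, c2, c3, c4, 1:] = [:-a, 1:] * [:-b, 1:] * [:-c, 1:] * [:-d, 1:] * [:-e, 1:]"
proof -
  define p where "p = [:c0, c1, c2, c3, c4, 1:]"
  obtain xs where xs: "mset xs = proots p" using ex_mset by blast
  have "length xs = degree p" unfolding size_mset[symmetric] xs by (rule size_proots_complex)
  then have "length xs = 5" by (simp add: p_def)
  then obtain a b c d e where xs': "xs = [a, b, c, d, e]"
    by (auto simp: numeral_eq_Suc length_Suc_conv)
  have "smult (lead_coeff p) (\<Prod>x\<in>#proots p. [:-x, 1:]) = p" by (rule complex_poly_decompose_multiset)
  moreover have "proots p = {#a, b, c, d, e#}" using xs unfolding xs' by simp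
  moreover have "lead_coeff p = 1" by (simp add: p_def)
  ultimately have "p = [:-a, 1:] * [:-b, 1:] * [:-c, 1:] * [:-d, 1:] * [:-e, 1:]"
    by (simp only: image_mset_add_mset prod_mset.add_mset image_mset_empty prod_mset_empty
        smult_1_left mult_1_right mult.assoc)
  then show ?thesis using that by (simp only: p_def)
qed

text \<open>Polynomials in a root \<open>y\<close>, with coefficients that are polynomial functions of the quintic.\<close>
definition root_poly :: "(complex^6 \<Rightarrow> complex \<Rightarrow> complex) \<Rightarrow> bool" where
  "root_poly g \<longleftrightarrow> (\<exists>n G. (\<forall>j. polyfun (G j)) \<and> (\<forall>v y. g v y = (\<Sum>j<n. G j v * y ^ j)))"

lemma polyfun_if: "(P \<Longrightarrow> polyfun F) \<Longrightarrow> polyfun (\<lambda>v. if P then F v else 0)"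
  by (cases P) (auto intro: polyfun.const)

lemma root_poly_monom: "polyfun F \<Longrightarrow> root_poly (\<lambda>v y. F v * y ^ k)"
  unfolding root_poly_def
  by (intro exI[of _ "Suc k"] exI[of _ "\<lambda>j v. if j = k then F v else 0"])
    (auto intro!: polyfun_if simp: if_distribR cong: if_cong)

lemma root_poly_add:
  assumes "root_poly g" "root_poly h"
  shows "root_poly (\<lambda>v y. g v y + h v y)"
proof -
  obtain n G m H where G: "\<forall>j. polyfun (G j)" "\<forall>v y. g v y = (\<Sum>j<n. G j v * y ^ j)"
    and H: "\<forall>j. polyfun (H j)" "\<forall>v y. h v y = (\<Sum>j<m. H j v * y ^ j)"
    using assms unfolding root_poly_def by blast
  define K where "K j v = (if j < n then G j v else 0) + (if j < m then H j v else 0)" for j v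
  have "polyfun (K j)" for j
    unfolding K_def using G(1) H(1) by (intro polyfun.add polyfun_if) auto
  moreover have "g v y + h v y = (\<Sum>j<n + m. K j v * y ^ j)" for v y
  proof -
    have "(\<Sum>j<n. G j v * y ^ j) = (\<Sum>j<n + m. (if j < n then G j v else 0) * y ^ j)"
      by (rule sum.mono_neutral_cong_left) auto
    moreover have "(\<Sum>j<m. H j v * y ^ j) = (\<Sum>j<n + m. (if j < m then H j v else 0) * y ^ j)"
      by (rule sum.mono_neutral_cong_left) auto
    ultimately show ?thesis by (simp add: G H K_def algebra_simps sum.distrib)
  qed
  ultimately show ?thesis unfolding root_poly_def by blast
qed

lemma root_poly_sum: "(\<And>i. i < n \<Longrightarrow> root_poly (g i)) \<Longrightarrow> root_poly (\<lambda>v y. \<Sum>i<n. g i v y)" for n :: nat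
proof (induction n)
  case 0
  show ?case using root_poly_monom[OF polyfun.const[of 0], of 0] by simp
next
  case (Suc n)
  then show ?case by (simp add: root_poly_add)
qed

lemma root_poly_mult:
  assumes "root_poly g" "root_poly h"
  shows "root_poly (\<lambda>v y. g v y * h v y)"
proof -
  obtain n G m H where G: "\<forall>j. polyfun (G j)" "\<forall>v y. g v y = (\<Sum>j<n. G j v * y ^ j)"
    and H: "\<forall>j. polyfun (H j)" "\<forall>v y. h v y = (\<Sum>j<m. H j v * y ^ j)"
    using assms unfolding root_poly_def by blast
  have "g v y * h v y = (\<Sum>i<n. \<Sum>j<m. (G i v * H j v) * y ^ (i + j))" for v y
    by (simp add: G H sum_product power_add mult_ac)
  then show ?thesis
    by (simp only:) (intro root_poly_sum root_poly_monom polyfun.mult G(1)[rule_format] H(1)[rule_format])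
qed

lemma root_poly_const: "polyfun F \<Longrightarrow> root_poly (\<lambda>v y. F v)"
  using root_poly_monom[of F 0] by simp

lemma root_poly_var: "root_poly (\<lambda>v y. y)"
  using root_poly_monom[OF polyfun.const[of 1], of 1] by simp

lemma root_poly_power: "root_poly g \<Longrightarrow> root_poly (\<lambda>v y. g v y ^ n)"
  by (induction n) (auto intro: root_poly_mult root_poly_const polyfun.const)

lemma root_poly_diff: "root_poly g \<Longrightarrow> root_poly h \<Longrightarrow> root_poly (\<lambda>v y. g v y - h v y)"
  using root_poly_add[OF _ root_poly_mult[OF root_poly_const[OF polyfun.const[of "-1"]]], of g h] by simp

text \<open>Newton's formulas for the small exponents, and the linear recurrence given by the equation of the roots for the
  others.\<close>
lemma power_sum_polyfun:
  "\<exists>S. polyfun S \<and> (\<forall>v a b c d e. scaled_roots v a b c d e \<longrightarrow> S v = a^n + b^n + c^n + d^n + e^n)"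
proof (induction n rule: less_induct)
  case (less n)
  consider "n = 0" | "n = 1" | "n = 2" | "n = 3" | "n = 4" | k where "n = k + 5"
  proof -
    have "n = 0 \<or> n = 1 \<or> n = 2 \<or> n = 3 \<or> n = 4 \<or> n = (n - 5) + 5" by arith
    then show ?thesis using that by blast
  qed
  then show ?case
  proof cases
    case 1
    then show ?thesis by (intro exI[of _ "\<lambda>v. 5"]) (auto intro: polyfun.intros)
  next
    case 2
    then show ?thesis
      by (intro exI[of _ "\<lambda>v. - v$2"]) (auto intro!: polyfun_intros simp: scaled_roots_iff)
  next
    case 3
    have "s1^2 - 2 * s2 = a^2 + b^2 + c^2 + d^2 + e^2"
      if "s1 = - (a + b + c + d + e)" "s2 = a*b + a*c + a*d + a*e + b*c + b*d + b*e + c*d + c*e + d*e"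
      for s1 s2 a b c d e :: complex
      unfolding that by algebra
    with 3 show ?thesis
      by (intro exI[of _ "\<lambda>v. (v$2)^2 - 2 * (v$1 * v$3)"])
        (auto intro!: polyfun_intros simp: scaled_roots_iff)
  next
    case 4
    have "- (s1^3) + 3 * (s1 * s2) - 3 * s3 = a^3 + b^3 + c^3 + d^3 + e^3"
      if "s1 = - (a + b + c + d + e)" "s2 = a*b + a*c + a*d + a*e + b*c + b*d + b*e + c*d + c*e + d*e"
        "s3 = - (a*b*c + a*b*d + a*b*e + a*c*d + a*c*e + a*d*e + b*c*d + b*c*e + b*d*e + c*d*e)"
      for s1 s2 s3 a b c d e :: complex
      unfolding that by algebra
    with 4 show ?thesis
      by (intro exI[of _ "\<lambda>v. - ((v$2)^3) + 3 * (v$2 * (v$1 * v$3)) - 3 * (v$1^2 * v$4)"])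
        (auto intro!: polyfun_intros simp: scaled_roots_iff)
  next
    case 5
    have "(- s1)^4 - 4 * (- s1)^2 * s2 + 2 * s2^2 + 4 * (- s1) * (- s3) - 4 * s4 = a^4 + b^4 + c^4 + d^4 + e^4"
      if "s1 = - (a + b + c + d + e)" "s2 = a*b + a*c + a*d + a*e + b*c + b*d + b*e + c*d + c*e + d*e"
        "s3 = - (a*b*c + a*b*d + a*b*e + a*c*d + a*c*e + a*d*e + b*c*d + b*c*e + b*d*e + c*d*e)"
        "s4 = a*b*c*d + a*b*c*e + a*b*d*e + a*c*d*e + b*c*d*e" for s1 s2 s3 s4 a b c d e :: complex
      unfolding that by algebra
    with 5 show ?thesis
      by (intro exI[of _ "\<lambda>v. (- (v$2))^4 - 4 * (- (v$2))^2 * (v$1 * v$3) + 2 * (v$1 * v$3)^2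
            + 4 * (- (v$2)) * (- (v$1^2 * v$4)) - 4 * (v$1^3 * v$5)"])
        (auto intro!: polyfun_intros simp: scaled_roots_iff)
  next
    case (6 k)
    have IH: "\<exists>S. polyfun S \<and> (\<forall>v a b c d e. scaled_roots v a b c d e \<longrightarrow> S v = a^i + b^i + c^i + d^i + e^i)"
      if "i < n" for i using less that by blast
    obtain S where S: "\<And>i. i < n \<Longrightarrow> polyfun (S i)"
      "\<And>i v a b c d e. i < n \<Longrightarrow> scaled_roots v a b c d e \<Longrightarrow> S i v = a^i + b^i + c^i + d^i + e^i"
      using IH by metis
    have rt: "y^n = - (v$2 * y^(k+4) + v$1 * v$3 * y^(k+3) + v$1^2 * v$4 * y^(k+2) + v$1^3 * v$5 * y^(k+1) + v$1^4 * v$6 * y^k)"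
      if "scaled_roots v a b c d e" "y \<in> {a, b, c, d, e}" for v y a b c d e
    proof -
      have "poly [:v$1^4 * v$6, v$1^3 * v$5, v$1^2 * v$4, v$1 * v$3, v$2, 1:] y
          = poly ([:-a, 1:] * [:-b, 1:] * [:-c, 1:] * [:-d, 1:] * [:-e, 1:]) y"
        using that(1) by (simp only: scaled_roots_def)
      also have "\<dots> = 0" using that(2) unfolding poly_mult by auto
      finally have "poly [:v$1^4 * v$6, v$1^3 * v$5, v$1^2 * v$4, v$1 * v$3, v$2, 1:] y = 0" .
      then have "y^5 = - (v$2 * y^4 + v$1 * v$3 * y^3 + v$1^2 * v$4 * y^2 + v$1^3 * v$5 * y + v$1^4 * v$6)"
        by (simp add: algebra_simps power_numeral_reduce) (simp add: eq_neg_iff_add_eq_0 algebra_simps)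
      then have "y^k * y^5 = y^k * - (v$2 * y^4 + v$1 * v$3 * y^3 + v$1^2 * v$4 * y^2 + v$1^3 * v$5 * y + v$1^4 * v$6)"
        by simp
      then show ?thesis unfolding 6 by (simp add: power_add power2_eq_square algebra_simps)
    qed
    show ?thesis
    proof (intro exI[of _ "\<lambda>v. - (v$2 * S (k+4) v + v$1 * v$3 * S (k+3) v + v$1^2 * v$4 * S (k+2) v
          + v$1^3 * v$5 * S (k+1) v + v$1^4 * v$6 * S k v)"] conjI allI impI)
      fix v a b c d e assume r: "scaled_roots v a b c d e"
      show "- (v$2 * S (k+4) v + v$1 * v$3 * S (k+3) v + v$1^2 * v$4 * S (k+2) v
          + v$1^3 * v$5 * S (k+1) v + v$1^4 * v$6 * S k v) = a^n + b^n + c^n + d^n + e^n"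
      proof -
        have S_eq: "S (k+4) v = a^(k+4) + b^(k+4) + c^(k+4) + d^(k+4) + e^(k+4)"
          "S (k+3) v = a^(k+3) + b^(k+3) + c^(k+3) + d^(k+3) + e^(k+3)"
          "S (k+2) v = a^(k+2) + b^(k+2) + c^(k+2) + d^(k+2) + e^(k+2)"
          "S (k+1) v = a^(k+1) + b^(k+1) + c^(k+1) + d^(k+1) + e^(k+1)"
          "S k v = a^k + b^k + c^k + d^k + e^k"
          using 6 by (intro S(2)[OF _ r]; simp)+
        have "y^n = - (v$2 * y^(k+4) + v$1 * v$3 * y^(k+3) + v$1^2 * v$4 * y^(k+2)
            + v$1^3 * v$5 * y^(k+1) + v$1^4 * v$6 * y^k)" if "y \<in> {a, b, c, d, e}" for y
          using rt[OF r that] .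
        then have sum_eq: "a^n + b^n + c^n + d^n + e^n =
            - (v$2 * a^(k+4) + v$1 * v$3 * a^(k+3) + v$1^2 * v$4 * a^(k+2) + v$1^3 * v$5 * a^(k+1) + v$1^4 * v$6 * a^k)
            - (v$2 * b^(k+4) + v$1 * v$3 * b^(k+3) + v$1^2 * v$4 * b^(k+2) + v$1^3 * v$5 * b^(k+1) + v$1^4 * v$6 * b^k)
            - (v$2 * c^(k+4) + v$1 * v$3 * c^(k+3) + v$1^2 * v$4 * c^(k+2) + v$1^3 * v$5 * c^(k+1) + v$1^4 * v$6 * c^k)
            - (v$2 * d^(k+4) + v$1 * v$3 * d^(k+3) + v$1^2 * v$4 * d^(k+2) + v$1^3 * v$5 * d^(k+1) + v$1^4 * v$6 * d^k)
            - (v$2 * e^(k+4) + v$1 * v$3 * e^(k+3) + v$1^2 * v$4 * e^(k+2) + v$1^3 * v$5 * e^(k+1) + v$1^4 * v$6 * e^k)"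
          by simp
        show ?thesis unfolding S_eq sum_eq by (simp only: distrib_left minus_add_distrib diff_conv_add_uminus add_ac)
      qed
    qed (use S(1) 6 in \<open>auto intro!: polyfun_intros\<close>)
  qed
qed

lemma root_sum_polyfun:
  assumes "root_poly g"
  shows "\<exists>S. polyfun S \<and> (\<forall>v a b c d e. scaled_roots v a b c d e \<longrightarrow>
     S v = g v a + g v b + g v c + g v d + g v e)"
proof -
  obtain n G where G: "\<forall>j. polyfun (G j)" "\<forall>v y. g v y = (\<Sum>j<n. G j v * y ^ j)"
    using assms unfolding root_poly_def by blast
  obtain S where S: "\<And>i. polyfun (S i)"
      "\<And>i v a b c d e. scaled_roots v a b c d e \<Longrightarrow> S i v = a^i + b^i + c^i + d^i + e^i"
    using power_sum_polyfun by metis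
  show ?thesis
    by (intro exI[of _ "\<lambda>v. \<Sum>j<n. G j v * S j v"])
      (auto intro!: polyfun_intros simp: S G sum.distrib algebra_simps)
qed

lemma newton_product5:
  fixes a b c d e :: complex
  defines "p n \<equiv> a^n + b^n + c^n + d^n + e^n"
  shows "p 1^5 - 10 * p 1^3 * p 2 + 15 * p 1 * p 2^2 + 20 * p 1^2 * p 3 - 20 * p 2 * p 3
    - 30 * p 1 * p 4 + 24 * p 5 = 120 * (a * b * c * d * e)"
  unfolding p_def by algebra

text \<open>A product over the roots is polynomial in the quintic: by Newton it is a polynomial in the power sums of the
  factors, which are sums over the roots.\<close>
lemma root_prod_polyfun:
  assumes "root_poly g"
  shows "\<exists>P. polyfun P \<and> (\<forall>v a b c d e. scaled_roots v a b c d e \<longrightarrow>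
     P v = g v a * g v b * g v c * g v d * g v e)"
proof -
  have "\<exists>S. polyfun S \<and> (\<forall>v a b c d e. scaled_roots v a b c d e \<longrightarrow>
     S v = g v a ^ n + g v b ^ n + g v c ^ n + g v d ^ n + g v e ^ n)" for n
    using root_sum_polyfun[OF root_poly_power[OF assms]] .
  then obtain S where S: "\<And>n. polyfun (S n)"
      "\<And>n v a b c d e. scaled_roots v a b c d e \<Longrightarrow>
        S n v = g v a ^ n + g v b ^ n + g v c ^ n + g v d ^ n + g v e ^ n"
    by metis
  show ?thesis
  proof (intro exI[of _ "\<lambda>v. (1 / 120) * (S 1 v^5 - 10 * S 1 v^3 * S 2 v + 15 * S 1 v * S 2 v^2
      + 20 * S 1 v^2 * S 3 v - 20 * S 2 v * S 3 v - 30 * S 1 v * S 4 v + 24 * S 5 v)"] conjI allI impI)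
    fix v a b c d e assume r: "scaled_roots v a b c d e"
    show "(1 / 120) * (S 1 v^5 - 10 * S 1 v^3 * S 2 v + 15 * S 1 v * S 2 v^2
      + 20 * S 1 v^2 * S 3 v - 20 * S 2 v * S 3 v - 30 * S 1 v * S 4 v + 24 * S 5 v)
      = g v a * g v b * g v c * g v d * g v e"
      unfolding S(2)[OF r] newton_product5 by simp
  qed (intro polyfun_intros S(1))
qed

text \<open>At a root \<open>y\<close> of the monic quintic, \<open>p0, \<dots>, p3\<close> are the first Taylor coefficients, up to sign the elementary symmetric
  functions of the differences of the other roots to \<open>y\<close>. The result is, up to sign, the leading coefficient of the sextic
  covariant of the quartic that has those roots when \<open>y\<close> is moved to infinity; this covariant is the product of the three
  Jacobians of pairs.\<close>
definition covariant_at :: "complex^6 \<Rightarrow> complex \<Rightarrow> complex" where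
  "covariant_at v y = (let p0 = 5*y^4 + 4*(v$2)*y^3 + 3*(v$1* v$3)*y^2 + 2*(v$1^2* v$4)*y + v$1^3* v$5;
      p1 = 10*y^3 + 6*(v$2)*y^2 + 3*(v$1* v$3)*y + v$1^2* v$4;
      p2 = 10*y^2 + 4*(v$2)*y + v$1* v$3;
      p3 = 5*y + v$2
    in 4*p0*p1*p2 - 8*p0^2*p3 - p1^3)"

lemma root_poly_covariant_at: "root_poly covariant_at"
  unfolding covariant_at_def[abs_def] Let_def
  by (intro root_poly_diff root_poly_add root_poly_mult root_poly_power root_poly_var root_poly_const polyfun_intros)

lemma covariant_at_root:
  assumes "scaled_roots v y a b c d"
  shows "covariant_at v y = invol_aff3 y a b c d"
proof -
  define A B C D where "A = a - y" "B = b - y" "C = c - y" "D = d - y"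
  then have y: "a = A + y" "b = B + y" "c = C + y" "d = D + y" by simp_all
  note v = assms[unfolded scaled_roots_iff y]
  have "5*y^4 + 4*(v$2)*y^3 + 3*(v$1* v$3)*y^2 + 2*(v$1^2* v$4)*y + v$1^3* v$5 = A*B*C*D"
    using v by algebra
  moreover have "10*y^3 + 6*(v$2)*y^2 + 3*(v$1* v$3)*y + v$1^2* v$4 = - (A*B*C + A*B*D + A*C*D + B*C*D)"
    using v by algebra
  moreover have "10*y^2 + 4*(v$2)*y + v$1* v$3 = A*B + A*C + A*D + B*C + B*D + C*D"
    using v by algebra
  moreover have "5*y + v$2 = - (A + B + C + D)"
    using v by algebra
  moreover have "invol_aff y (P + y) (Q + y) (R + y) (S + y) = P * R * (S - Q) + Q * S * (R - P)" for P Q R S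
    by (simp add: invol_aff_def)
  moreover have "4 * (A*B*C*D) * - (A*B*C + A*B*D + A*C*D + B*C*D) * (A*B + A*C + A*D + B*C + B*D + C*D)
      - 8 * (A*B*C*D)^2 * - (A + B + C + D) - (- (A*B*C + A*B*D + A*C*D + B*C*D))^3
    = (A * C * (D - B) + B * D * (C - A)) * (A * B * (D - C) + C * D * (B - A))
      * (A * B * (C - D) + D * C * (B - A))"
    by algebra
  ultimately show ?thesis unfolding covariant_at_def invol_aff3_def y
    by (simp only: Let_def)
qed

lemma scaled_roots_swap:
  assumes "scaled_roots v a b c d e"
  shows "scaled_roots v b a c d e" "scaled_roots v c a b d e" "scaled_roots v d a b c e" "scaled_roots v e a b c d"
  using assms by (auto simp: scaled_roots_iff algebra_simps)

lemma scaled_roots_exist: obtains a b c d e where "scaled_roots v a b c d e"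
  using monic_quintic_splits unfolding scaled_roots_def by metis

text \<open>Up to a constant, such a function is \<open>(v $ 1)\<^sup>2\<^sup>7\<close> times Hermite's invariant of degree \<open>18\<close>. The
  extra factor is harmless at quintics with nonzero leading coefficient.\<close>
definition involution_invariant :: "(complex^6 \<Rightarrow> complex) \<Rightarrow> bool" where
  "involution_invariant I \<longleftrightarrow> homogeneous 45 I \<and>
     (\<forall>v a b c d e. scaled_roots v a b c d e \<longrightarrow> I v = invol_prod a b c d e)"

lemma involution_invariantD:
  assumes "involution_invariant I"
  shows "polyfun I" "scaled_roots v a b c d e \<Longrightarrow> I v = invol_prod a b c d e"
  using assms by (auto simp: involution_invariant_def homogeneous_def)

text \<open>The product of \<open>covariant_at\<close> over the five roots. A scaling of the quintic scales the roots, and each of the fifteen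
  factors is cubic in them.\<close>
lemma involution_invariant_exists: "\<exists>I. involution_invariant I"
proof -
  obtain I where I: "polyfun I" "\<And>v a b c d e. scaled_roots v a b c d e \<Longrightarrow>
     I v = covariant_at v a * covariant_at v b * covariant_at v c * covariant_at v d * covariant_at v e"
    using root_prod_polyfun[OF root_poly_covariant_at] by blast
  have I': "I v = invol_prod a b c d e" if "scaled_roots v a b c d e" for v a b c d e
    using I(2)[OF that] scaled_roots_swap[OF that] that by (simp add: covariant_at_root invol_prod_def)
  have "I (k *s v) = k ^ 45 * I v" for k v
  proof -
    obtain a b c d e where r: "scaled_roots v a b c d e" by (rule scaled_roots_exist)
    have "scaled_roots (k *s v) (k * a) (k * b) (k * c) (k * d) (k * e)"
    proof -
      note r' = r[unfolded scaled_roots_iff]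
      show ?thesis unfolding scaled_roots_iff vector_smult_component
        by (intro conjI; use r' in algebra)
    qed
    moreover have invol_aff: "invol_aff (k * c) (k * d) (k * e) (k * f) (k * g) = k^3 * invol_aff c d e f g" for c d e f g
      unfolding invol_aff_def by algebra
    have invol_aff3: "invol_aff3 (k * c) (k * d) (k * e) (k * f) (k * g) = k^9 * invol_aff3 c d e f g" for c d e f g
      unfolding invol_aff3_def invol_aff by algebra
    have "invol_prod (k * a) (k * b) (k * c) (k * d) (k * e) = k ^ 45 * invol_prod a b c d e"
      unfolding invol_prod_def invol_aff3 by algebra
    ultimately show ?thesis using I' r by metis
  qed
  then show ?thesis using I(1) I' unfolding homogeneous_def involution_invariant_def by blast
qed

text \<open>The scaled roots of a product of linear forms are polynomials in their coefficients, and one of the fifteen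
  factors is a multiple of \<open>invol c a b d e\<close>.\<close>
lemma invariant_vanishing:
  assumes I: "involution_invariant I" and A: "det A = 1"
  shows "(\<lambda>v. I (subst_vars A v)) \<in> vanishing involution_divisors"
proof -
  have 1: "I (k *s prod5 a b d e c) = 0" if inv: "invol c a b d e = 0" for k a b c d e
  proof -
    define ya yb yd ye yc where "ya = - k * a$2 * b$1 * d$1 * e$1 * c$1" "yb = - k * a$1 * b$2 * d$1 * e$1 * c$1"
      "yd = - k * a$1 * b$1 * d$2 * e$1 * c$1" "ye = - k * a$1 * b$1 * d$1 * e$2 * c$1"
      "yc = - k * a$1 * b$1 * d$1 * e$1 * c$2"
    note y = this
    have "scaled_roots (k *s prod5 a b d e c) yc ya yb yd ye"
      unfolding scaled_roots_iff vector_smult_component prod5_def mul_lin_nth vec6_nth y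
      by (intro conjI; algebra)
    moreover have "invol_aff yc ya yb yd ye = k^3 * (a$1 * b$1 * d$1 * e$1)^2 * c$1 * invol c a b d e"
      unfolding invol_aff_def invol_def bracket_def y by algebra
    then have "invol_prod yc ya yb yd ye = 0" using inv by (simp add: invol_prod_def invol_aff3_def)
    ultimately show ?thesis using involution_invariantD(2)[OF I] by metis
  qed
  have "I (subst_vars A v) = 0" if p: "p \<in> involution_divisors" "v \<in> p" for p v
  proof -
    obtain a b d e c where "invol c a b d e = 0" "p = range (\<lambda>k. k *s prod5 a b d e c)"
      using p(1) by (rule involution_divisorsD)
    then show ?thesis using p(2) 1 A by (auto simp: subst_vars_scale subst_vars_prod5 invol_mult)
  qed
  moreover have "homogeneous 45 (\<lambda>v. I (subst_vars A v))"
    using I by (auto simp: involution_invariant_def homogeneous_def subst_vars_scale polyfun_subst_vars)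
  ultimately show ?thesis unfolding vanishing_def by blast
qed

section \<open>Forms with two involutions\<close>

definition root_form :: "complex \<Rightarrow> complex^2" where
  "root_form y = vector [1, - y]"

definition roots5 :: "complex \<Rightarrow> complex \<Rightarrow> complex \<Rightarrow> complex \<Rightarrow> complex \<Rightarrow> complex^6" where
  "roots5 a b c d e = prod5 (root_form a) (root_form b) (root_form c) (root_form d) (root_form e)"

text \<open>Scalar factors do not matter for points of projective space, and a square root of the determinant of \<open>C\<close> can be
  traded for such a factor, so this describes the six orbits.\<close>
definition in_orbits :: "complex^6 \<Rightarrow> bool" where
  "in_orbits v \<longleftrightarrow> (\<exists>C k. \<exists>u\<in>base_quintics. det C \<noteq> 0 \<and> v = k *s subst_vars C u)"

lemma form_root_form: "form (root_form y) x = x$1 - y * x$2"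
  by (simp add: form2 root_form_def)

lemma form_roots5: "form (roots5 a b c d e) x = (x$1 - a * x$2) * (x$1 - b * x$2) * (x$1 - c * x$2) * (x$1 - d * x$2) * (x$1 - e * x$2)"
  by (simp add: roots5_def form_prod5 form_root_form)

lemma scaled_roots_roots5: "scaled_roots (roots5 a b c d e) a b c d e"
  unfolding scaled_roots_iff roots5_def prod5_def mul_lin_nth vec6_nth root_form_def
  by (simp add: algebra_simps)

lemma in_orbitsI:
  assumes "u \<in> base_quintics" "p * s - q * r \<noteq> 0" "k \<noteq> 0"
    and "\<And>x. form u (x v* mat2 p q r s) = k * form v x"
  shows "in_orbits v"
  unfolding in_orbits_def
proof (intro exI bexI conjI)
  show "det (mat2 p q r s) \<noteq> 0" using assms(2) by (simp add: det_mat2)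
  show "v = (1 / k) *s subst_vars (mat2 p q r s) u"
    by (rule form_inj) (use assms(3) in \<open>simp add: form_scale form_subst_vars assms(4)\<close>)
qed fact

text \<open>A quintic with a triple root is determined, up to substitution, by the coincidences among its other roots: three points
  of the projective line can be moved anywhere.\<close>
lemma triple_root_in_orbits: "in_orbits (roots5 a a a b c)"
proof -
  consider "b = a" "c = a" | "b = a" "c \<noteq> a" | "b \<noteq> a" "c = a" | "b \<noteq> a" "b = c" | "b \<noteq> a" "c \<noteq> a" "b \<noteq> c"
    by blast
  then show ?thesis
  proof cases
    case 1
    then show ?thesis
      by (intro in_orbitsI[of "vec6 1 0 0 0 0 0" 1 1 "-a" 0 1])
        (simp_all add: base_quintics_def form_roots5 form_vec6 mult_mat2 power_numeral_reduce)
  next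
    case 2
    then show ?thesis
      by (intro in_orbitsI[of "vec6 0 1 0 0 0 0" 1 "-c" "-a" 1 1])
        (simp_all add: base_quintics_def form_roots5 form_vec6 mult_mat2 power_numeral_reduce)
  next
    case 3
    then show ?thesis
      by (intro in_orbitsI[of "vec6 0 1 0 0 0 0" 1 "-b" "-a" 1 1])
        (simp_all add: base_quintics_def form_roots5 form_vec6 mult_mat2 power_numeral_reduce)
  next
    case 4
    then show ?thesis
      by (intro in_orbitsI[of "vec6 0 0 1 0 0 0" 1 "-b" "-a" 1 1])
        (simp_all add: base_quintics_def form_roots5 form_vec6 mult_mat2 power_numeral_reduce)
  next
    case 5
    have *: "(c - b) * (x - a * y) + (a - c) * (x - b * y) = (a - b) * (x - c * y)" for x y
      by (simp add: algebra_simps)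
    show ?thesis
    proof (rule in_orbitsI[of "vec6 0 1 1 0 0 0" "c - b" "- (a - c) * b" "- (c - b) * a" "a - c"
        "(c - b)^3 * (a - c) * (a - b)"])
      show "(c - b) * (- (a - c) * b) - - (c - b) * a * (a - c) \<noteq> 0"
      proof -
        have "(c - b) * (- (a - c) * b) - - (c - b) * a * (a - c) = (c - b) * (a - c) * (a - b)"
          by (simp add: algebra_simps)
        then show ?thesis using 5 by simp
      qed
      fix x :: "complex^2"
      have X: "(x v* mat2 (c - b) (- (c - b) * a) (a - c) (- (a - c) * b)) $ 1 = (c - b) * (x$1 - a * x$2)"
        "(x v* mat2 (c - b) (- (c - b) * a) (a - c) (- (a - c) * b)) $ 2 = (a - c) * (x$1 - b * x$2)"
        by (simp_all add: mult_mat2 algebra_simps)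
      have "form (vec6 0 1 1 0 0 0) z = z$1^3 * z$2 * (z$1 + z$2)" for z
        unfolding form_vec6 by algebra
      then have "form (vec6 0 1 1 0 0 0) (x v* mat2 (c - b) (- (c - b) * a) (a - c) (- (a - c) * b))
        = ((c - b) * (x$1 - a * x$2))^3 * ((a - c) * (x$1 - b * x$2))
          * ((c - b) * (x$1 - a * x$2) + (a - c) * (x$1 - b * x$2))"
        by (simp only: X)
      also have "\<dots> = ((c - b)^3 * (a - c) * (a - b)) * form (roots5 a a a b c) x"
        unfolding * form_roots5 by algebra
      finally show "form (vec6 0 1 1 0 0 0) (x v* mat2 (c - b) (- (c - b) * a) (a - c) (- (a - c) * b))
        = ((c - b)^3 * (a - c) * (a - b)) * form (roots5 a a a b c) x" .
    qed (use 5 in \<open>simp_all add: base_quintics_def\<close>)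
  qed
qed

lemma triple_in_orbits:
  assumes "a = b \<and> b = c \<or> a = b \<and> b = d \<or> a = b \<and> b = e \<or> a = c \<and> c = d \<or> a = c \<and> c = e
    \<or> a = d \<and> d = e \<or> b = c \<and> c = d \<or> b = c \<and> c = e \<or> b = d \<and> d = e \<or> c = d \<and> d = e"
  shows "in_orbits (roots5 a b c d e)"
proof -
  have "in_orbits (roots5 a b a a c)" "in_orbits (roots5 a b a c a)"
    "in_orbits (roots5 a b c a a)" "in_orbits (roots5 b a a a c)"
    "in_orbits (roots5 b a a c a)" "in_orbits (roots5 b a c a a)"
    "in_orbits (roots5 b c a a a)" "in_orbits (roots5 a a b a c)"
    "in_orbits (roots5 a a b c a)" for a b c
    by (rule back_subst[of in_orbits, OF triple_root_in_orbits[of a b c]], rule form_inj, simp add: form_roots5)+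
  with assms triple_root_in_orbits show ?thesis by auto
qed

text \<open>Two involutions that fix \<open>c\<close> and \<open>d\<close>, respectively, and both exchange \<open>f\<close> and \<open>g\<close>. With \<open>f\<close> at \<open>0\<close> and \<open>g\<close> at infinity
  they say \<open>c\<^sup>2 = d e\<close> and \<open>d\<^sup>2 = c e\<close>, so \<open>c, d, e\<close> differ by cube roots of unity and the form is in the orbit of \<open>U2\<close>. In the
  proof, \<open>c1 / c2\<close> is the coordinate of \<open>c\<close> in this frame.\<close>
lemma dihedral3_distinct_in_orbits:
  assumes E: "invol_aff c d e f g = 0" "invol_aff d c e f g = 0"
    and ne: "c \<noteq> d" "f \<noteq> g" "c \<noteq> f" "d \<noteq> f" "e \<noteq> f" "c \<noteq> g" "d \<noteq> g" "e \<noteq> g"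
  shows "in_orbits (roots5 c d e f g)"
proof -
  define c1 c2 d1 d2 e1 e2 where "c1 = c - f" "c2 = c - g" "d1 = d - f" "d2 = d - g" "e1 = e - f" "e2 = e - g"
  note defs = this
  have K1: "c1^2 * d2 * e2 = d1 * e1 * c2^2" and K2: "d1^2 * c2 * e2 = c1 * e1 * d2^2"
    using E unfolding invol_aff_def defs by algebra+
  have "(c1 * d2 - d1 * c2) * (c1 * d2 * e2 + d1 * c2 * e2 + e1 * c2 * d2) = 0"
    using K1 K2 by algebra
  moreover have "c1 * d2 - d1 * c2 = (d - c) * (g - f)" unfolding defs by algebra
  ultimately have S1: "c1 * d2 * e2 + d1 * c2 * e2 + e1 * c2 * d2 = 0" using ne by simp
  then have "c2 * (c1 * d1 * e2 + c1 * e1 * d2 + d1 * e1 * c2) = 0" using K1 by algebra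
  then have S2: "c1 * d1 * e2 + c1 * e1 * d2 + d1 * e1 * c2 = 0" using ne by (simp add: defs)
  obtain p where p: "p ^ 3 = c2 * d2 * e2" using complex_root[of 3] by auto
  obtain q where q: "q ^ 3 = c1 * d1 * e1" using complex_root[of 3] by auto
  have pq: "p \<noteq> 0" "q \<noteq> 0" using p q ne by (auto simp: defs)
  show ?thesis
  proof (rule in_orbitsI[of "vec6 0 1 0 0 (-1) 0" p "- q * g" "- p * f" q "(f - g)^3 * p * q"])
    have "p * (- q * g) - - p * f * q = p * q * (f - g)" by (simp add: algebra_simps)
    then show "p * (- q * g) - - p * f * q \<noteq> 0" using pq ne by simp
    fix x :: "complex^2"
    define l m where "l = x$1 - f * x$2" "m = x$1 - g * x$2"
    have X: "(x v* mat2 p (- p * f) q (- q * g)) $ 1 = p * l" "(x v* mat2 p (- p * f) q (- q * g)) $ 2 = q * m"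
      by (simp_all add: mult_mat2 l_m_def algebra_simps)
    have root_form: "(f - g) * (x$1 - c * x$2) = c2 * l - c1 * m" "(f - g) * (x$1 - d * x$2) = d2 * l - d1 * m"
      "(f - g) * (x$1 - e * x$2) = e2 * l - e1 * m"
      unfolding defs l_m_def by algebra+
    have "(f - g)^3 * ((x$1 - c * x$2) * (x$1 - d * x$2) * (x$1 - e * x$2))
      = (c2 * l - c1 * m) * (d2 * l - d1 * m) * (e2 * l - e1 * m)"
      unfolding root_form[symmetric] by algebra
    also have "\<dots> = p^3 * l^3 - q^3 * m^3"
      unfolding p q using S1 S2 by algebra
    finally have cubic: "(f - g)^3 * ((x$1 - c * x$2) * (x$1 - d * x$2) * (x$1 - e * x$2)) = p^3 * l^3 - q^3 * m^3" .
    have "form (vec6 0 1 0 0 (-1) 0) (x v* mat2 p (- p * f) q (- q * g)) = (p * l * (q * m)) * (p^3 * l^3 - q^3 * m^3)"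
      unfolding form_vec6 X by algebra
    also have "\<dots> = ((f - g)^3 * p * q)
        * ((x$1 - c * x$2) * (x$1 - d * x$2) * (x$1 - e * x$2) * l * m)"
      unfolding cubic[symmetric] by algebra
    also have "\<dots> = ((f - g)^3 * p * q) * form (roots5 c d e f g) x"
      unfolding form_roots5 l_m_def ..
    finally show "form (vec6 0 1 0 0 (-1) 0) (x v* mat2 p (- p * f) q (- q * g))
      = ((f - g)^3 * p * q) * form (roots5 c d e f g) x" .
  qed (use pq ne in \<open>simp_all add: base_quintics_def\<close>)
qed

text \<open>Two involutions that fix \<open>c\<close> and \<open>d\<close>, respectively, and whose composition is a five-cycle of the roots. In the
  coordinate \<open>u = 1 / (x - c)\<close> the first is the reflection in a point \<open>h\<close>, and the other four roots are \<open>h \<plusminus> \<delta>\<close> and \<open>h \<plusminus> \<phi>\<close>. The second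
  involution then says \<open>\<delta>\<^sup>2 - \<phi>\<^sup>2 = 4 \<delta> \<phi>\<close>, and the form is \<open>l (m\<^sup>2 - \<delta>\<^sup>2 l\<^sup>2) (m\<^sup>2 - \<phi>\<^sup>2 l\<^sup>2)\<close> up to a factor. This is a multiple
  of \<open>(m + q l)\<^sup>5 + (q l - m)\<^sup>5\<close> if \<open>2 q\<^sup>2 = - (\<delta>\<^sup>2 + \<phi>\<^sup>2)\<close>: the condition on the last coefficient, \<open>q\<^sup>4 = 5 \<delta>\<^sup>2 \<phi>\<^sup>2\<close>, is the relation
  between \<open>\<delta>\<close> and \<open>\<phi>\<close>.\<close>
lemma dihedral5_distinct_in_orbits:
  assumes E: "invol_aff c d e f g = 0" "invol_aff d c f e g = 0"
    and ne: "c \<noteq> d" "c \<noteq> e" "c \<noteq> f" "c \<noteq> g" "d \<noteq> e" "f \<noteq> g"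
  shows "in_orbits (roots5 c d e f g)"
proof -
  define ud ue uf ug where "ud = 1 / (d - c)" "ue = 1 / (e - c)" "uf = 1 / (f - c)" "ug = 1 / (g - c)"
  note u = this
  have u0: "ud \<noteq> 0" "ue \<noteq> 0" "uf \<noteq> 0" "ug \<noteq> 0" using ne by (simp_all add: u)
  have du: "ud * (d - c) = 1" "ue * (e - c) = 1" "uf * (f - c) = 1" "ug * (g - c) = 1"
    using ne by (simp_all add: u)
  have "ud + ue - uf - ug = (ud * ue * uf * ug) * invol_aff c d e f g"
    using du unfolding invol_aff_def by algebra
  then have "ud + ue - uf - ug = 0" using E(1) by simp
  then have sum: "ud + ue = uf + ug" by algebra
  define h \<delta> \<phi> where "h = (ud + ue) / 2" "\<delta> = (ud - ue) / 2" "\<phi> = (uf - ug) / 2"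
  have "2 * h = ud + ue" "2 * \<delta> = ud - ue" "2 * \<phi> = uf - ug" by (simp_all add: h_\<delta>_\<phi>_def)
  then have "2 * ud = 2 * (h + \<delta>)" "2 * ue = 2 * (h - \<delta>)" "2 * uf = 2 * (h + \<phi>)" "2 * ug = 2 * (h - \<phi>)"
    using sum by algebra+
  then have ud: "ud = h + \<delta>" "ue = h - \<delta>" "uf = h + \<phi>" "ug = h - \<phi>"
    by (simp_all only: mult_cancel_left zero_neq_numeral[symmetric] simp_thms)
  have "(ud - uf) * (ud - ug) - (ud - ue) * (uf - ug) = (ud^2 * ue * uf * ug) * invol_aff d c f e g"
    using du unfolding invol_aff_def by algebra
  then have "\<delta>^2 - \<phi>^2 - 4 * \<delta> * \<phi> = 0"
    unfolding E(2) ud by (simp add: power2_eq_square algebra_simps)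
  then have K: "(\<delta>^2 + \<phi>^2)^2 = 20 * \<delta>^2 * \<phi>^2" by algebra
  have dp: "\<delta> \<noteq> 0" "\<phi> \<noteq> 0" using ne by (auto simp: h_\<delta>_\<phi>_def u)
  define q where "q = csqrt (- (\<delta>^2 + \<phi>^2) / 2)"
  have q2: "2 * q^2 = - (\<delta>^2 + \<phi>^2)" by (simp add: q_def)
  have q4: "q^4 = 5 * \<delta>^2 * \<phi>^2" using q2 K by algebra
  have q0: "q \<noteq> 0" using q4 dp by auto
  show ?thesis
  proof (rule in_orbitsI[of "vec6 1 0 0 0 0 1" "q - h" "- (q + h) * c - 1" "- (q - h) * c + 1" "q + h"
      "10 * q * (ud * ue * uf * ug)"])
    have "(q - h) * (- (q + h) * c - 1) - (- (q - h) * c + 1) * (q + h) = - 2 * q" by algebra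
    then show "(q - h) * (- (q + h) * c - 1) - (- (q - h) * c + 1) * (q + h) \<noteq> 0" using q0 by simp
    fix x :: "complex^2"
    define l m where "l = x$1 - c * x$2" "m = x$2 - h * l"
    let ?A = "mat2 (q - h) (- (q - h) * c + 1) (q + h) (- (q + h) * c - 1)"
    have X: "(x v* ?A) $ 1 = m + q * l" "(x v* ?A) $ 2 = q * l - m"
      by (simp_all add: mult_mat2 l_m_def algebra_simps)
    have root_form: "ud * (x$1 - d * x$2) = \<delta> * l - m" "ue * (x$1 - e * x$2) = - \<delta> * l - m"
      "uf * (x$1 - f * x$2) = \<phi> * l - m" "ug * (x$1 - g * x$2) = - \<phi> * l - m"
      using du unfolding ud l_m_def by algebra+
    have "form (vec6 1 0 0 0 0 1) (x v* ?A) = 10 * q * (l * ((\<delta> * l - m) * (- \<delta> * l - m) * (\<phi> * l - m) * (- \<phi> * l - m)))"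
      unfolding form_vec6 X using q2 q4 by algebra
    also have "\<dots> = (10 * q * (ud * ue * uf * ug))
        * (l * (x$1 - d * x$2) * (x$1 - e * x$2) * (x$1 - f * x$2) * (x$1 - g * x$2))"
      unfolding root_form[symmetric] by algebra
    also have "\<dots> = (10 * q * (ud * ue * uf * ug)) * form (roots5 c d e f g) x"
      unfolding form_roots5 l_m_def ..
    finally show "form (vec6 1 0 0 0 0 1) (x v* ?A) = (10 * q * (ud * ue * uf * ug)) * form (roots5 c d e f g) x" .
  qed (use q0 u0 in \<open>simp_all add: base_quintics_def\<close>)
qed

lemma invol_aff_sym: "invol_aff c e d f g = invol_aff c d e f g" "invol_aff c d e g f = invol_aff c d e f g" "invol_aff c f g d e = - invol_aff c d e f g"
  unfolding invol_aff_def by algebra+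

text \<open>If two of the roots coincide, the two conditions force a triple root.\<close>
lemma dihedral3_in_orbits:
  assumes E: "invol_aff c d e f g = 0" "invol_aff d c e f g = 0"
  shows "in_orbits (roots5 c d e f g)"
proof (cases "c \<noteq> d \<and> f \<noteq> g \<and> c \<noteq> f \<and> d \<noteq> f \<and> e \<noteq> f \<and> c \<noteq> g \<and> d \<noteq> g \<and> e \<noteq> g")
  case True
  then show ?thesis using dihedral3_distinct_in_orbits[OF E] by blast
next
  case False
  have cd: ?thesis if "c = d"
  proof -
    have "(e - c) * (g - c) * (f - c) = 0" using E(1) unfolding that[symmetric] invol_aff_def by algebra
    then show ?thesis using that by (intro triple_in_orbits) auto
  qed
  have cf: ?thesis if "c = f"
  proof -
    have "(e - c) * (g - c) * (c - d) = 0" using E(1) unfolding that[symmetric] invol_aff_def by algebra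
    then show ?thesis using that by (intro triple_in_orbits) auto
  qed
  have cg: ?thesis if "c = g"
  proof -
    have "(d - c) * (f - c) * (c - e) = 0" using E(1) unfolding that[symmetric] invol_aff_def by algebra
    then show ?thesis using that by (intro triple_in_orbits) auto
  qed
  have df: ?thesis if "d = f"
  proof -
    have "(e - d) * (g - d) * (d - c) = 0" using E(2) unfolding that[symmetric] invol_aff_def by algebra
    then show ?thesis using that by (intro triple_in_orbits) auto
  qed
  have dg: ?thesis if "d = g"
  proof -
    have "(c - d) * (f - d) * (d - e) = 0" using E(2) unfolding that[symmetric] invol_aff_def by algebra
    then show ?thesis using that by (intro triple_in_orbits) auto
  qed
  have ef: ?thesis if "e = f"
  proof -
    have "(e - c) * ((d - c) * (g - e) + (g - c) * (e - d)) = 0"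
      using E(1) unfolding that[symmetric] invol_aff_def by algebra
    moreover have "(d - c) * (g - e) + (g - c) * (e - d) = (c - e) * (d - g)" by algebra
    ultimately have "c = f \<or> d = g" using that by auto
    then show ?thesis using cf dg by blast
  qed
  have eg: ?thesis if "e = g"
  proof -
    have "(e - c) * (e - c) * (f - d) = 0" using E(1) unfolding that[symmetric] invol_aff_def by algebra
    then have "c = g \<or> d = f" using that by auto
    then show ?thesis using cg df by blast
  qed
  have fg: ?thesis if "f = g"
  proof -
    have "(f - c) * ((d - c) * (f - e) + (e - c) * (f - d)) = 0"
      "(f - d) * ((c - d) * (f - e) + (e - d) * (f - c)) = 0"
      using E unfolding that[symmetric] invol_aff_def by algebra+
    moreover have "3 * ((e - f) * (c - d)) = ((d - c) * (f - e) + (e - c) * (f - d))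
        - ((c - d) * (f - e) + (e - d) * (f - c))" by algebra
    ultimately have "c = f \<or> d = f \<or> e = f \<or> c = d" by auto
    then show ?thesis using cd cf df ef by blast
  qed
  show ?thesis using False cd cf cg df dg ef eg fg by blast
qed

text \<open>Again, coinciding roots lead to a triple root.\<close>
lemma dihedral5_in_orbits:
  assumes E: "invol_aff c d e f g = 0" "invol_aff d c f e g = 0"
  shows "in_orbits (roots5 c d e f g)"
proof (cases "c \<noteq> d \<and> c \<noteq> e \<and> c \<noteq> f \<and> c \<noteq> g \<and> d \<noteq> e \<and> f \<noteq> g")
  case True
  then show ?thesis using dihedral5_distinct_in_orbits[OF E] by blast
next
  case False
  have cd: ?thesis if "c = d"
  proof -
    have "(e - c) * (g - c) * (f - c) = 0" using E(1) unfolding that[symmetric] invol_aff_def by algebra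
    then show ?thesis using that by (intro triple_in_orbits) auto
  qed
  have ce: ?thesis if "c = e"
  proof -
    have "(d - c) * (f - c) * (g - c) = 0" using E(1) unfolding that[symmetric] invol_aff_def by algebra
    then show ?thesis using that by (intro triple_in_orbits) auto
  qed
  have cf: ?thesis if "c = f"
  proof -
    have "(e - c) * (g - c) * (c - d) = 0" using E(1) unfolding that[symmetric] invol_aff_def by algebra
    then show ?thesis using that by (intro triple_in_orbits) auto
  qed
  have cg: ?thesis if "c = g"
  proof -
    have "(d - c) * (f - c) * (c - e) = 0" using E(1) unfolding that[symmetric] invol_aff_def by algebra
    then show ?thesis using that by (intro triple_in_orbits) auto
  qed
  have de: ?thesis if "d = e"
  proof -
    have "(f - d) * (g - d) * (d - c) = 0" using E(2) unfolding that[symmetric] invol_aff_def by algebra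
    then show ?thesis using that by (intro triple_in_orbits) auto
  qed
  have fg: ?thesis if "f = g"
  proof -
    have "(f - d) * (f - d) * (e - c) = 0" using E(2) unfolding that[symmetric] invol_aff_def by algebra
    then have "(d = f \<and> f = g) \<or> c = e" using that by auto
    then show ?thesis using ce by (auto intro: triple_in_orbits)
  qed
  show ?thesis using False cd ce cf cg de fg by blast
qed

section \<open>Regularity at all other points\<close>

text \<open>At a singular point, \<open>I\<close> vanishes to higher than first order in the parameter \<open>t\<^sup>n\<close> of a line.\<close>
lemma singular_curve:
  assumes I: "polyfun I" "singular_at I v" and n: "n > 0" and K: "isCont K 0"
    and eq: "\<And>t. I (v + t ^ n *s \<rho>) = t ^ n * K t"
  shows "K 0 = 0"
proof -
  obtain G where G: "\<And>v w h. I (v + h *s w) = I v + h * G (v, w, h)" "continuous_on UNIV G"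
    "\<And>v w. dir_deriv I v w = G (v, w, 0)"
    "\<And>v w w'. G (v, w + w', 0) = G (v, w, 0) + G (v, w', 0)"
    "\<And>v w c. G (v, c *s w, 0) = c * G (v, w, 0)"
    by (rule polyfun_secant_deriv[OF I(1)]) (rule that)
  have "isCont (\<lambda>t. G (v, \<rho>, t ^ n)) 0"
    by (intro isCont_compose_UNIV[OF G(2)] continuous_intros)
  with K have "isCont (\<lambda>t. G (v, \<rho>, t ^ n) - K t) 0" by (intro continuous_intros)
  moreover have "G (v, \<rho>, t ^ n) - K t = 0" if "t \<noteq> 0" for t
    using eq[of t] G(1)[of v "t ^ n" \<rho>] I(2) that by (simp add: singular_at_def)
  ultimately have "G (v, \<rho>, 0 ^ n) - K 0 = 0" by (rule isCont_const_zero)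
  then show ?thesis using n I(2) G(3)[of v \<rho>] by (simp add: zero_power singular_at_def)
qed

text \<open>For the form \<open>a\<^sup>2 b\<^sup>2 c\<close> two of the fifteen factors vanish, one for each way to pair the two roots \<open>a\<close> with the two roots \<open>b\<close>.
  The point is nevertheless regular, because the roots ramify there: on the line \<open>(l\<^sub>a\<^sup>2 - t\<^sup>2 x\<^sub>2\<^sup>2) l\<^sub>b\<^sup>2 l\<^sub>c\<close> with parameter \<open>t\<^sup>2\<close> the
  root \<open>a\<close> splits into \<open>a \<plusminus> t\<close>, and each of the two factors is a multiple of \<open>t\<close>, so that their product is of first order in \<open>t\<^sup>2\<close>.\<close>
lemma double_double_regular:
  assumes ii: "involution_invariant I"
    and sing: "singular_at I (roots5 c a a b b)"
  shows "a = b \<or> a = c \<or> b = c"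
proof (rule ccontr)
  note I = involution_invariantD[OF ii]
  assume ne: "\<not> ?thesis"
  define \<rho> where "\<rho> = (-1) *s prod5 (root_form c) (vector [0, 1]) (vector [0, 1]) (root_form b) (root_form b)"
  define K where "K t = 4 * (b - c)^4 * invol_aff c (a + t) (a - t) b b * invol_aff3 (a + t) c (a - t) b b
    * invol_aff3 (a - t) c (a + t) b b * invol_aff3 b c (a + t) (a - t) b * invol_aff3 b c (a + t) (a - t) b" for t
  have "K 0 = 0"
  proof (rule singular_curve[OF I(1) sing, of 2])
    show "isCont K 0" unfolding K_def invol_aff3_def invol_aff_def by (intro continuous_intros)
    fix t
    have "roots5 c a a b b + t^2 *s \<rho> = roots5 c (a + t) (a - t) b b"
    proof (rule form_inj)
      fix x
      have x2: "form (vector [0, 1] :: complex^2) x = x$2" by (simp add: form2)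
      show "form (roots5 c a a b b + t^2 *s \<rho>) x = form (roots5 c (a + t) (a - t) b b) x"
        unfolding \<rho>_def form_add form_scale form_prod5 form_roots5 form_root_form x2 by algebra
    qed
    then have "I (roots5 c a a b b + t^2 *s \<rho>) = invol_prod c (a + t) (a - t) b b"
      by (simp add: I(2)[OF scaled_roots_roots5])
    also have "\<dots> = t^2 * K t"
    proof -
      have "invol_aff3 c (a + t) (a - t) b b = t^2 * (4 * (b - c)^4) * invol_aff c (a + t) (a - t) b b"
        unfolding invol_aff3_def invol_aff_def by algebra
      then show ?thesis unfolding invol_prod_def K_def by simp
    qed
    finally show "I (roots5 c a a b b + t^2 *s \<rho>) = t^2 * K t" .
  qed simp
  moreover have "invol_aff c a a b b = 2 * (a - c) * (b - c) * (b - a)" "invol_aff3 a c a b b = ((c - a) * (b - a) * (b - a))^3"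
    "invol_aff3 b c a a b = ((c - b) * (a - b) * (a - b))^3"
    unfolding invol_aff3_def invol_aff_def by algebra+
  ultimately show False using ne by (auto simp: K_def)
qed

text \<open>The fourteen factors of \<open>invol_prod\<close> besides \<open>invol_aff c d e f g\<close>.\<close>
definition other_invol_affs :: "complex \<Rightarrow> complex \<Rightarrow> complex \<Rightarrow> complex \<Rightarrow> complex \<Rightarrow> complex" where
  "other_invol_affs c d e f g = invol_aff c d f e g * invol_aff c d g e f * invol_aff3 d c e f g * invol_aff3 e c d f g
     * invol_aff3 f c d e g * invol_aff3 g c d e f"

text \<open>If only one factor vanishes, then at a singular point its derivatives with respect to the roots \<open>d, e, f, g\<close> vanish. The factor is
  linear in each of these roots, so moving one root along a line detects the derivative. The four equations leave only triple roots.\<close>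
lemma single_factor_regular:
  assumes ii: "involution_invariant I"
    and sing: "singular_at I (roots5 c d e f g)" and E: "invol_aff c d e f g = 0"
    and rest: "other_invol_affs c d e f g \<noteq> 0"
  shows "(c = d \<and> d = e) \<or> (c = f \<and> f = g) \<or> (d = e \<and> e = f)"
proof -
  note I = involution_invariantD[OF ii]
  have inv: "invol_prod c d e f g = invol_aff c d e f g * other_invol_affs c d e f g" for c d e f g
    unfolding invol_prod_def other_invol_affs_def invol_aff3_def[of c] by simp
  have move: "k * other_invol_affs c d e f g = 0"
    if \<rho>: "\<And>t. roots5 c d e f g + t ^ 1 *s \<rho> = roots5 c (d + t * p) (e + t * q) (f + t * r) (g + t * s)"
      and k: "\<And>t. invol_aff c (d + t * p) (e + t * q) (f + t * r) (g + t * s) = t * k" for \<rho> p q r s k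
  proof -
    define K where "K t = k * other_invol_affs c (d + t * p) (e + t * q) (f + t * r) (g + t * s)" for t
    have "K 0 = 0"
    proof (rule singular_curve[OF I(1) sing, of 1 K])
      show "isCont K 0" unfolding K_def other_invol_affs_def invol_aff3_def invol_aff_def by (intro continuous_intros)
      show "I (roots5 c d e f g + t ^ 1 *s \<rho>) = t ^ 1 * K t" for t
        unfolding \<rho> I(2)[OF scaled_roots_roots5] inv k K_def by simp
    qed simp
    then show ?thesis by (simp add: K_def)
  qed
  have x2: "form (vector [0, -1] :: complex^2) x = - (x$2)" for x by (simp add: form2)
  have "(f - c) * (g - e) - (e - c) * (g - c) = 0"
  proof -
    have "((f - c) * (g - e) - (e - c) * (g - c)) * other_invol_affs c d e f g = 0"
    proof (rule move[of "prod5 (root_form c) (vector [0, -1]) (root_form e) (root_form f) (root_form g)" 1 0 0 0])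
      show "roots5 c d e f g + t ^ 1 *s prod5 (root_form c) (vector [0, -1]) (root_form e) (root_form f) (root_form g)
          = roots5 c (d + t * 1) (e + t * 0) (f + t * 0) (g + t * 0)" for t
        by (rule form_inj) (unfold form_add form_scale form_prod5 form_roots5 form_root_form x2, algebra)
      show "invol_aff c (d + t * 1) (e + t * 0) (f + t * 0) (g + t * 0) = t * ((f - c) * (g - e) - (e - c) * (g - c))" for t
        using E unfolding invol_aff_def by algebra
    qed
    then show ?thesis using rest by simp
  qed
  moreover have "(g - c) * (f - d) - (d - c) * (f - c) = 0"
  proof -
    have "((g - c) * (f - d) - (d - c) * (f - c)) * other_invol_affs c d e f g = 0"
    proof (rule move[of "prod5 (root_form c) (root_form d) (vector [0, -1]) (root_form f) (root_form g)" 0 1 0 0])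
      show "roots5 c d e f g + t ^ 1 *s prod5 (root_form c) (root_form d) (vector [0, -1]) (root_form f) (root_form g)
          = roots5 c (d + t * 0) (e + t * 1) (f + t * 0) (g + t * 0)" for t
        by (rule form_inj) (unfold form_add form_scale form_prod5 form_roots5 form_root_form x2, algebra)
      show "invol_aff c (d + t * 0) (e + t * 1) (f + t * 0) (g + t * 0) = t * ((g - c) * (f - d) - (d - c) * (f - c))" for t
        using E unfolding invol_aff_def by algebra
    qed
    then show ?thesis using rest by simp
  qed
  moreover have "(d - c) * (g - e) + (e - c) * (g - c) = 0"
  proof -
    have "((d - c) * (g - e) + (e - c) * (g - c)) * other_invol_affs c d e f g = 0"
    proof (rule move[of "prod5 (root_form c) (root_form d) (root_form e) (vector [0, -1]) (root_form g)" 0 0 1 0])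
      show "roots5 c d e f g + t ^ 1 *s prod5 (root_form c) (root_form d) (root_form e) (vector [0, -1]) (root_form g)
          = roots5 c (d + t * 0) (e + t * 0) (f + t * 1) (g + t * 0)" for t
        by (rule form_inj) (unfold form_add form_scale form_prod5 form_roots5 form_root_form x2, algebra)
      show "invol_aff c (d + t * 0) (e + t * 0) (f + t * 1) (g + t * 0) = t * ((d - c) * (g - e) + (e - c) * (g - c))" for t
        using E unfolding invol_aff_def by algebra
    qed
    then show ?thesis using rest by simp
  qed
  moreover have "(d - c) * (f - c) + (e - c) * (f - d) = 0"
  proof -
    have "((d - c) * (f - c) + (e - c) * (f - d)) * other_invol_affs c d e f g = 0"
    proof (rule move[of "prod5 (root_form c) (root_form d) (root_form e) (root_form f) (vector [0, -1])" 0 0 0 1])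
      show "roots5 c d e f g + t ^ 1 *s prod5 (root_form c) (root_form d) (root_form e) (root_form f) (vector [0, -1])
          = roots5 c (d + t * 0) (e + t * 0) (f + t * 0) (g + t * 1)" for t
        by (rule form_inj) (unfold form_add form_scale form_prod5 form_roots5 form_root_form x2, algebra)
      show "invol_aff c (d + t * 0) (e + t * 0) (f + t * 0) (g + t * 1) = t * ((d - c) * (f - c) + (e - c) * (f - d))" for t
        using E unfolding invol_aff_def by algebra
    qed
    then show ?thesis using rest by simp
  qed
  moreover define D E' F G where "D = d - c" "E' = e - c" "F = f - c" "G = g - c"
  moreover note defs = this
  have subst_vars: "g - e = G - E'" "f - d = F - D" unfolding defs by simp_all
  ultimately have *: "F * (G - E') - E' * G = 0" "G * (F - D) - D * F = 0"
      "D * (G - E') + E' * G = 0" "D * F + E' * (F - D) = 0"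
    by (simp_all only: subst_vars)
  show ?thesis
  proof (cases "D = E'")
    case True
    show ?thesis
    proof (cases "F = G")
      case True
      with \<open>D = E'\<close> E have "2 * D * F * (F - D) = 0" unfolding invol_aff_def defs by algebra
      then show ?thesis using True \<open>D = E'\<close> unfolding defs by auto
    next
      case False
      have "(D + E') * (F - G) = 0" using * by algebra
      with False have "D + E' = 0" by simp
      with True have "D = 0" by simp
      with True show ?thesis unfolding defs by simp
    qed
  next
    case False
    have "(F + G) * (D - E') = 0" using * by algebra
    with False have "F + G = 0" by simp
    then have "F * F = 0" "G = - F" using * by algebra+
    then show ?thesis unfolding defs by simp
  qed
qed

text \<open>Two involutions with the same fixed root \<open>c\<close>. With \<open>c\<close> at infinity they are reflections, \<open>d + e = f + g\<close> and \<open>d + f = e + g\<close>,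
  so \<open>d = g\<close> and \<open>e = f\<close>; this leaves the form \<open>c d\<^sup>2 e\<^sup>2\<close>, which is regular unless it has a triple root.\<close>
lemma same_centre_in_orbits:
  assumes ii: "involution_invariant I"
    and sing: "singular_at I (roots5 c d e f g)" and E: "invol_aff c d e f g = 0" "invol_aff c d f e g = 0"
  shows "in_orbits (roots5 c d e f g)"
proof -
  have "2 * ((e - c) * (f - c) * (g - d)) = 0" "2 * ((d - c) * (g - c) * (f - e)) = 0"
    using E unfolding invol_aff_def by algebra+
  then have *: "e = c \<or> f = c \<or> g = d" "d = c \<or> g = c \<or> f = e" by auto
  show ?thesis
  proof (cases "g = d \<and> f = e")
    case True
    have "roots5 c d e e d = roots5 c d d e e"
      by (rule form_inj) (simp add: form_roots5)
    with True sing have "singular_at I (roots5 c d d e e)" by simp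
    from double_double_regular[OF ii this] True show ?thesis
      by (intro triple_in_orbits) auto
  next
    case False
    with * show ?thesis by (intro triple_in_orbits) auto
  qed
qed

text \<open>Unless there is a triple root, a second of the fifteen factors must vanish. The second involution has the same fixed root as the first one, or exchanges the same
  pair of roots besides the two fixed ones, or composes with the first to a five-cycle.\<close>
lemma singular_in_orbits_wlog:
  assumes ii: "involution_invariant I"
    and sing: "singular_at I (roots5 c d e f g)" and E: "invol_aff c d e f g = 0"
  shows "in_orbits (roots5 c d e f g)"
proof (cases "other_invol_affs c d e f g = 0")
  case False
  from single_factor_regular[OF ii sing E False] show ?thesis
    by (intro triple_in_orbits) blast
next
  case True
  have S: "roots5 c d e g f = roots5 c d e f g" "roots5 c e d f g = roots5 c d e f g"
    "roots5 c e d g f = roots5 c d e f g" "roots5 c f g d e = roots5 c d e f g"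
    "roots5 c f g e d = roots5 c d e f g" "roots5 c g f d e = roots5 c d e f g"
    "roots5 c g f e d = roots5 c d e f g"
    by (rule form_inj, simp add: form_roots5)+
  have E': "invol_aff c d e g f = 0" "invol_aff c e d f g = 0" "invol_aff c e d g f = 0" "invol_aff c f g d e = 0"
    "invol_aff c f g e d = 0" "invol_aff c g f d e = 0" "invol_aff c g f e d = 0"
    using E unfolding invol_aff_def by algebra+
  from True have "invol_aff c d f e g = 0 \<or> invol_aff c d g e f = 0 \<or>
      invol_aff d c e f g = 0 \<or> invol_aff d c f e g = 0 \<or> invol_aff d c g e f = 0 \<or>
      invol_aff e c d f g = 0 \<or> invol_aff e c f d g = 0 \<or> invol_aff e c g d f = 0 \<or>
      invol_aff f c d e g = 0 \<or> invol_aff f c e d g = 0 \<or> invol_aff f c g d e = 0 \<or>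
      invol_aff g c d e f = 0 \<or> invol_aff g c e d f = 0 \<or> invol_aff g c f d e = 0"
    unfolding other_invol_affs_def invol_aff3_def mult_eq_0_iff by blast
  then show ?thesis
  proof (elim disjE)
    assume "invol_aff c d f e g = 0"
    with same_centre_in_orbits[OF ii sing E] show ?thesis .
  next
    assume "invol_aff c d g e f = 0"
    with same_centre_in_orbits[OF ii _ E'(1)] sing show ?thesis unfolding S .
  next
    assume "invol_aff d c e f g = 0"
    with dihedral3_in_orbits[OF E] show ?thesis .
  next
    assume "invol_aff d c f e g = 0"
    with dihedral5_in_orbits[OF E] show ?thesis .
  next
    assume "invol_aff d c g e f = 0"
    with dihedral5_in_orbits[OF E'(1)] show ?thesis unfolding S .
  next
    assume "invol_aff e c d f g = 0"
    with dihedral3_in_orbits[OF E'(2)] show ?thesis unfolding S .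
  next
    assume "invol_aff e c f d g = 0"
    with dihedral5_in_orbits[OF E'(2)] show ?thesis unfolding S .
  next
    assume "invol_aff e c g d f = 0"
    with dihedral5_in_orbits[OF E'(3)] show ?thesis unfolding S .
  next
    assume "invol_aff f c d e g = 0"
    then have "invol_aff f c d g e = 0" by (simp add: invol_aff_sym(2)[of f c d g e])
    with dihedral5_in_orbits[OF E'(4)] show ?thesis unfolding S .
  next
    assume "invol_aff f c e d g = 0"
    then have "invol_aff f c e g d = 0" by (simp add: invol_aff_sym(2)[of f c e g d])
    with dihedral5_in_orbits[OF E'(5)] show ?thesis unfolding S .
  next
    assume "invol_aff f c g d e = 0"
    with dihedral3_in_orbits[OF E'(4)] show ?thesis unfolding S .
  next
    assume "invol_aff g c d e f = 0"
    then have "invol_aff g c d f e = 0" by (simp add: invol_aff_sym(2)[of g c d f e])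
    with dihedral5_in_orbits[OF E'(6)] show ?thesis unfolding S .
  next
    assume "invol_aff g c e d f = 0"
    then have "invol_aff g c e f d = 0" by (simp add: invol_aff_sym(2)[of g c e f d])
    with dihedral5_in_orbits[OF E'(7)] show ?thesis unfolding S .
  next
    assume "invol_aff g c f d e = 0"
    with dihedral3_in_orbits[OF E'(6)] show ?thesis unfolding S .
  qed
qed

lemma singular_in_orbits:
  assumes ii: "involution_invariant I"
    and sing: "singular_at I (roots5 a b c d e)"
  shows "in_orbits (roots5 a b c d e)"
proof -
  note I = involution_invariantD[OF ii]
  have "I (roots5 a b c d e) = invol_prod a b c d e" using I(2) scaled_roots_roots5 .
  with sing have "invol_prod a b c d e = 0" by (simp add: singular_at_def)
  then have *: "invol_aff a b c d e = 0 \<or> invol_aff a b d c e = 0 \<or> invol_aff a b e c d = 0 \<or>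
      invol_aff b a c d e = 0 \<or> invol_aff b a d c e = 0 \<or> invol_aff b a e c d = 0 \<or>
      invol_aff c a b d e = 0 \<or> invol_aff c a d b e = 0 \<or> invol_aff c a e b d = 0 \<or>
      invol_aff d a b c e = 0 \<or> invol_aff d a c b e = 0 \<or> invol_aff d a e b c = 0 \<or>
      invol_aff e a b c d = 0 \<or> invol_aff e a c b d = 0 \<or> invol_aff e a d b c = 0"
    unfolding invol_prod_def invol_aff3_def mult_eq_0_iff by blast
  have S: "roots5 a b d c e = roots5 a b c d e" "roots5 a b e c d = roots5 a b c d e"
      "roots5 b a c d e = roots5 a b c d e" "roots5 b a d c e = roots5 a b c d e" "roots5 b a e c d = roots5 a b c d e"
      "roots5 c a b d e = roots5 a b c d e" "roots5 c a d b e = roots5 a b c d e" "roots5 c a e b d = roots5 a b c d e"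
      "roots5 d a b c e = roots5 a b c d e" "roots5 d a c b e = roots5 a b c d e" "roots5 d a e b c = roots5 a b c d e"
      "roots5 e a b c d = roots5 a b c d e" "roots5 e a c b d = roots5 a b c d e" "roots5 e a d b c = roots5 a b c d e"
    by (rule form_inj, simp add: form_roots5)+
  note W = singular_in_orbits_wlog[OF ii]
  show ?thesis
    using * W[of a b c d e] W[of a b d c e] W[of a b e c d] W[of b a c d e] W[of b a d c e] W[of b a e c d]
      W[of c a b d e] W[of c a d b e] W[of c a e b d] W[of d a b c e] W[of d a c b e] W[of d a e b c]
      W[of e a b c d] W[of e a c b d] W[of e a d b c] sing
    unfolding S by blast
qed

section \<open>The singular locus\<close>

text \<open>Used to move a point where a given form does not vanish to \<open>(1, 0)\<close>, which makes its leading coefficient nonzero.\<close>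
lemma exists_sl2_row:
  fixes x :: "complex^2"
  assumes "x \<noteq> 0"
  obtains A :: "complex^2^2" where "det A = 1" "vector [1, 0] v* A = x"
proof -
  have row: "vector [1, 0] v* mat2 (x$1) q (x$2) s = x" for q s
    by (simp add: vec_eq_iff forall_2 mult_mat2)
  show ?thesis
  proof (cases "x$1 = 0")
    case True
    then have "x$2 \<noteq> 0" using assms by (auto simp: vec_eq_iff forall_2)
    with True that[OF _ row, of "- 1 / x$2" 0] show ?thesis by (simp add: det_mat2)
  next
    case False
    with that[OF _ row, of 0 "1 / x$1"] show ?thesis by (simp add: det_mat2)
  qed
qed

lemma monic_roots5:
  assumes "v $ 1 = 1"
  obtains a b c d e where "v = roots5 a b c d e"
proof -
  obtain a b c d e where r: "scaled_roots v a b c d e" by (rule scaled_roots_exist)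
  have "roots5 a b c d e $ 1 = 1" by (simp add: roots5_def prod5_def root_form_def)
  with r scaled_roots_roots5[of a b c d e] assms have "v = roots5 a b c d e"
    unfolding scaled_roots_iff by (simp add: vec6_eq_iff)
  then show ?thesis by (rule that)
qed

text \<open>After a substitution and rescaling, a representative has leading coefficient \<open>1\<close>, so that it is \<open>roots5\<close> of its roots, and the involution invariant,
  composed with the substitution, is one of the functions whose differential vanishes.\<close>
lemma singular_orbit:
  assumes "p \<in> hypersurface_sing involution_hypersurface"
  shows "\<exists>u\<in>base_quintics. \<exists>A. det A = 1 \<and> p = range (\<lambda>k. k *s subst_vars A u)"
proof -
  have "p \<in> proj_space"
    using assms unfolding hypersurface_sing_def involution_hypersurface_def zariski_closure_def by blast
  then obtain v where v: "v \<noteq> 0" "p = range (\<lambda>k. k *s v)" by (rule proj_spaceE)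
  have reg: "singular_at F (k *s v)" if "F \<in> vanishing involution_divisors" "k \<noteq> 0" for F k
    using hypersurface_sing_iff[OF v(1)] assms that unfolding v(2) by blast
  obtain x where x: "form v x \<noteq> 0" using v(1) form_inj[of v 0] by (auto simp: form6[of 0])
  then have "x \<noteq> 0" by (auto simp: form6)
  then obtain A :: "complex^2^2" where A: "det A = 1" "vector [1, 0] v* A = x" by (rule exists_sl2_row)
  obtain B where B: "A ** B = mat 1" using A(1) by (metis invertible_det_nz invertible_def zero_neq_one)
  have detB: "det B = 1" using A(1) arg_cong[OF B, of det] by (simp add: det_mul det_I)
  define k where "k = subst_vars A v $ 1"
  have "k = form (subst_vars A v) (vector [1, 0])" by (simp add: k_def form6)
  then have k: "k \<noteq> 0" using x by (simp add: form_subst_vars A(2))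
  have "subst_vars A ((1 / k) *s v) $ 1 = 1" using k by (simp add: subst_vars_scale k_def)
  then obtain a b c d e where r: "subst_vars A ((1 / k) *s v) = roots5 a b c d e" by (rule monic_roots5)
  obtain I where I: "involution_invariant I" using involution_invariant_exists by blast
  have s: "singular_at (\<lambda>v. I (subst_vars A v)) ((1 / k) *s v)"
    using k by (intro reg invariant_vanishing[OF I A(1)]) simp_all
  have "dir_deriv I (roots5 a b c d e) w = dir_deriv (\<lambda>v. I (subst_vars A v)) ((1 / k) *s v) (subst_vars B w)" for w
    unfolding dir_deriv_def subst_vars_add subst_vars_scale subst_vars_inverse(1)[OF B] r[symmetric] ..
  with s have "singular_at I (roots5 a b c d e)" unfolding singular_at_def r by simp
  then have "in_orbits (roots5 a b c d e)" by (rule singular_in_orbits[OF I])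
  then obtain C l u where C: "u \<in> base_quintics" "det C \<noteq> 0" "roots5 a b c d e = l *s subst_vars C u"
    unfolding in_orbits_def by blast
  obtain r' where r': "r' ^ 2 = det (B ** C)" using complex_root[of 2] by auto
  have r0: "r' \<noteq> 0" using r' C(2) detB by (auto simp: det_mul)
  define A' where "A' = mat2 (1 / r') 0 0 (1 / r') ** (B ** C)"
  have "det A' = 1" using r0 by (simp add: A'_def det_mul[of "mat2 _ _ _ _"] det_mat2 r'[symmetric] power2_eq_square)
  moreover have "p = range (\<lambda>k. k *s subst_vars A' u)"
  proof -
    have scalar: "subst_vars (mat2 (1 / r') 0 0 (1 / r')) w = (1 / r')^5 *s w" for w
      by (simp add: subst_vars_diag vec6_eq_iff power_numeral_reduce)
    have "v = k *s ((1 / k) *s v)" using k by simp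
    also have "(1 / k) *s v = subst_vars B (subst_vars A ((1 / k) *s v))" by (simp only: subst_vars_inverse(2)[OF B])
    also have "\<dots> = subst_vars B (roots5 a b c d e)" by (simp only: r)
    also have "\<dots> = l *s subst_vars (B ** C) u" by (simp only: C(3) subst_vars_scale subst_vars_compose)
    also have "subst_vars (B ** C) u = r'^5 *s subst_vars A' u"
      using r0 by (simp add: A'_def subst_vars_compose[symmetric] scalar power_divide)
    finally have v': "v = (k * l * r'^5) *s subst_vars A' u" by (simp add: mult.assoc)
    then have "k * l * r'^5 \<noteq> 0" using v(1) by auto
    from range_scale_eqI[OF this, of "subst_vars A' u"] show ?thesis unfolding v(2) v'[symmetric] .
  qed
  ultimately show ?thesis using C(1) by blast
qed

theorem theorem2p2:
  "hypersurface_sing involution_hypersurface =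
     (\<Union>U \<in> {U1, U2, U3, U4, U5, U6}. sl2_orbit U)"
proof -
  have "(\<Union>U \<in> {U1, U2, U3, U4, U5, U6}. sl2_orbit U)
    = {range (\<lambda>k. k *s subst_vars A u) |u A. u \<in> base_quintics \<and> det A = 1}"
    unfolding base_quintic_forms by (auto simp: sl2_orbit_form)
  also have "\<dots> = hypersurface_sing involution_hypersurface"
    using orbit_singular singular_orbit by blast
  finally show ?thesis ..
qed

end
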